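(* Let $n\ge 3$ be an odd integer and $G=\langle\sigma,\tau:\sigma^n=\tau^2=1,\ \tau\sigma\tau^{-1}=\sigma^{-1}\rangle\simeq D_n$. Then there is an isomorphism of $G$-lattices $\widetilde{M}_-\oplus\mathbb{Z}[G/\langle\tau\rangle]\simeq\mathbb{Z}[G]\oplus\mathbb{Z}$.
   Context: $D_n$ is the dihedral group of order $2n$. A $G$-lattice is a finitely generated $\mathbb{Z}[G]$-module that is torsion-free as an abelian group; $\mathbb{Z}$ denotes the rank-one lattice with trivial $G$-action, and for a subgroup $S\le G$, $\mathbb{Z}[G/S]$ is the permutation lattice on the left cosets of $S$. The $G$-lattice $\widetilde{M}_-$ of rank $n+1$ is the free abelian group with basis $w_0,\ldots,w_{n-1},w'$ (indices modulo $n$) and action $\sigma\cdot w_i=w_{i+1}$, $\tau\cdot w_i=-w_{-i}$, $\sigma\cdot w'=w'$, $\tau\cdot w'=w'-\sum_{0\le i\le n-1}w_i$. *)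

theory Defs
  imports "HOL-Algebra.Left_Coset" "HOL-Algebra.Generated_Groups"
    "HOL-Algebra.Free_Abelian_Groups" "HOL-Algebra.Module"
begin

section \<open>Modules over a not necessarily commutative ring\<close>

text \<open>The library locale \<open>module\<close> demands a commutative ring of scalars, which an integral group
  ring need not be.\<close>

locale left_module = R?: ring R + M?: abelian_group M
  for R :: "('a, 'r) ring_scheme" (structure) and M :: "('a, 'm, 'x) module_scheme" (structure) +
  assumes smult_closed:
      "\<lbrakk>a \<in> carrier R; x \<in> carrier M\<rbrakk> \<Longrightarrow> a \<odot>\<^bsub>M\<^esub> x \<in> carrier M"
    and smult_l_distr:
      "\<lbrakk>a \<in> carrier R; b \<in> carrier R; x \<in> carrier M\<rbrakk> \<Longrightarrow>
        (a \<oplus>\<^bsub>R\<^esub> b) \<odot>\<^bsub>M\<^esub> x = a \<odot>\<^bsub>M\<^esub> x \<oplus>\<^bsub>M\<^esub> b \<odot>\<^bsub>M\<^esub> x"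
    and smult_r_distr:
      "\<lbrakk>a \<in> carrier R; x \<in> carrier M; y \<in> carrier M\<rbrakk> \<Longrightarrow>
        a \<odot>\<^bsub>M\<^esub> (x \<oplus>\<^bsub>M\<^esub> y) = a \<odot>\<^bsub>M\<^esub> x \<oplus>\<^bsub>M\<^esub> a \<odot>\<^bsub>M\<^esub> y"
    and smult_assoc:
      "\<lbrakk>a \<in> carrier R; b \<in> carrier R; x \<in> carrier M\<rbrakk> \<Longrightarrow>
        (a \<otimes>\<^bsub>R\<^esub> b) \<odot>\<^bsub>M\<^esub> x = a \<odot>\<^bsub>M\<^esub> (b \<odot>\<^bsub>M\<^esub> x)"
    and smult_one:
      "x \<in> carrier M \<Longrightarrow> \<one>\<^bsub>R\<^esub> \<odot>\<^bsub>M\<^esub> x = x"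

definition finitely_generated_module ::
    "('a, 'r) ring_scheme \<Rightarrow> ('a, 'm, 'x) module_scheme \<Rightarrow> bool" where
  "finitely_generated_module R M \<longleftrightarrow>
     (\<exists>B \<subseteq> carrier M. finite B \<and>
       (\<forall>x \<in> carrier M. \<exists>a \<in> B \<rightarrow> carrier R. x = (\<Oplus>\<^bsub>M\<^esub>b\<in>B. a b \<odot>\<^bsub>M\<^esub> b)))"

definition additively_torsion_free :: "('m, 'x) ring_scheme \<Rightarrow> bool" where
  "additively_torsion_free M \<longleftrightarrow>
     (\<forall>k::int. \<forall>x \<in> carrier M. k \<noteq> 0 \<longrightarrow> [k] \<cdot>\<^bsub>M\<^esub> x = \<zero>\<^bsub>M\<^esub> \<longrightarrow> x = \<zero>\<^bsub>M\<^esub>)"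

definition module_iso ::
    "('a, 'r) ring_scheme \<Rightarrow> ('a, 'm, 'x) module_scheme \<Rightarrow> ('a, 'k, 'y) module_scheme \<Rightarrow> ('m \<Rightarrow> 'k) set"
  where
  "module_iso R M N = {f. bij_betw f (carrier M) (carrier N) \<and>
     (\<forall>x \<in> carrier M. \<forall>y \<in> carrier M. f (x \<oplus>\<^bsub>M\<^esub> y) = f x \<oplus>\<^bsub>N\<^esub> f y) \<and>
     (\<forall>a \<in> carrier R. \<forall>x \<in> carrier M. f (a \<odot>\<^bsub>M\<^esub> x) = a \<odot>\<^bsub>N\<^esub> f x)}"

text \<open>As in the library, the fields \<open>mult\<close> and \<open>one\<close> that a module record inherits from ring
  records carry no information.\<close>

definition direct_sum_module ::
    "('a, 'm) module \<Rightarrow> ('a, 'k) module \<Rightarrow> ('a, 'm \<times> 'k) module" where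
  "direct_sum_module M N =
     \<lparr>carrier = carrier M \<times> carrier N, mult = undefined, one = undefined,
      zero = (\<zero>\<^bsub>M\<^esub>, \<zero>\<^bsub>N\<^esub>),
      add = (\<lambda>(x, y) (x', y'). (x \<oplus>\<^bsub>M\<^esub> x', y \<oplus>\<^bsub>N\<^esub> y')),
      smult = (\<lambda>a (x, y). (a \<odot>\<^bsub>M\<^esub> x, a \<odot>\<^bsub>N\<^esub> y))\<rparr>"

section \<open>Integral group rings and lattices\<close>

text \<open>Formal integral combinations of elements of a set \<open>S\<close> are represented, as in
  \<^const>\<open>free_Abelian_group\<close>, by finitely supported functions with support in \<open>S\<close>. The basis
  element attached to \<open>x\<close> is \<open>frag_of x\<close>, and \<^const>\<open>frag_extend\<close> extends a map given on the
  basis to an additive map. Thus \<open>frag_of g\<close> is \<open>g\<close> as an element of the group ring.\<close>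

definition group_ring :: "('g, 'r) monoid_scheme \<Rightarrow> ('g \<Rightarrow>\<^sub>0 int) ring" where
  "group_ring G =
     \<lparr>carrier = carrier (free_Abelian_group (carrier G)),
      mult = (\<lambda>a b. frag_extend (\<lambda>g. frag_extend (\<lambda>h. frag_of (g \<otimes>\<^bsub>G\<^esub> h)) b) a),
      one = frag_of \<one>\<^bsub>G\<^esub>,
      zero = 0,
      add = (+)\<rparr>"

definition G_lattice ::
    "('g, 'r) monoid_scheme \<Rightarrow> ('g \<Rightarrow>\<^sub>0 int, 'm, 'x) module_scheme \<Rightarrow> bool" where
  "G_lattice G M \<longleftrightarrow>
     left_module (group_ring G) M \<and> finitely_generated_module (group_ring G) M \<and>
     additively_torsion_free M"

text \<open>That both sides really are lattices is part of being isomorphic lattices.\<close>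

definition G_lattices_isomorphic ::
    "('g, 'r) monoid_scheme \<Rightarrow> ('g \<Rightarrow>\<^sub>0 int, 'm, 'x) module_scheme \<Rightarrow>
     ('g \<Rightarrow>\<^sub>0 int, 'k, 'y) module_scheme \<Rightarrow> bool" where
  "G_lattices_isomorphic G M N \<longleftrightarrow>
     G_lattice G M \<and> G_lattice G N \<and> module_iso (group_ring G) M N \<noteq> {}"

definition regular_module :: "('g, 'r) monoid_scheme \<Rightarrow> ('g \<Rightarrow>\<^sub>0 int, 'g \<Rightarrow>\<^sub>0 int) module" where
  "regular_module G =
     \<lparr>carrier = carrier (group_ring G), mult = undefined, one = undefined,
      zero = \<zero>\<^bsub>group_ring G\<^esub>, add = add (group_ring G), smult = mult (group_ring G)\<rparr>"

text \<open>The trivial action of the group makes a group ring element act through its augmentation,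
  the sum of its coefficients.\<close>

definition trivial_module :: "('g \<Rightarrow>\<^sub>0 int, int) module" where
  "trivial_module =
     \<lparr>carrier = UNIV, mult = undefined, one = undefined, zero = 0, add = (+),
      smult = (\<lambda>a m. (\<Sum>g\<in>Poly_Mapping.keys a. Poly_Mapping.lookup a g) * m)\<rparr>"

text \<open>The free abelian group on \<open>S\<close>, where the group element \<open>g\<close> acts by the additive map
  \<open>act g\<close>, extended linearly to the group ring.\<close>

definition free_module_of_action ::
    "'b set \<Rightarrow> ('g \<Rightarrow> ('b \<Rightarrow>\<^sub>0 int) \<Rightarrow> ('b \<Rightarrow>\<^sub>0 int)) \<Rightarrow> ('g \<Rightarrow>\<^sub>0 int, 'b \<Rightarrow>\<^sub>0 int) module" where
  "free_module_of_action S act =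
     \<lparr>carrier = carrier (free_Abelian_group S), mult = undefined, one = undefined,
      zero = 0, add = (+),
      smult = (\<lambda>a m. frag_extend (\<lambda>g. act g m) a)\<rparr>"

definition permutation_module ::
    "('g, 'r) monoid_scheme \<Rightarrow> 'g set \<Rightarrow> ('g \<Rightarrow>\<^sub>0 int, 'g set \<Rightarrow>\<^sub>0 int) module" where
  "permutation_module G S =
     free_module_of_action (lcosets\<^bsub>G\<^esub> S) (\<lambda>g. frag_extend (\<lambda>C. frag_of (g <#\<^bsub>G\<^esub> C)))"

section \<open>Dihedral groups\<close>

locale dihedral_relations = group G for G (structure) +
  fixes n :: nat and \<sigma> \<tau>
  assumes sigma_closed [simp]: "\<sigma> \<in> carrier G" and tau_closed [simp]: "\<tau> \<in> carrier G"
    and sigma_pow: "\<sigma> [^] n = \<one>"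
    and tau_pow: "\<tau> [^] (2::nat) = \<one>"
    and conj: "\<tau> \<otimes> \<sigma> \<otimes> inv \<tau> = inv \<sigma>"

text \<open>The condition on the order excludes further relations: \<open>hom_exists\<close> below is the
  universal property of the group presented by \<open>\<sigma>\<close>, \<open>\<tau>\<close> and the above relations.\<close>

locale dihedral = dihedral_relations +
  assumes generated: "carrier G = generate G {\<sigma>, \<tau>}"
    and order: "order G = 2 * n"

context dihedral_relations
begin

lemma sigma_pow_mod: "\<sigma> [^] (i mod n) = \<sigma> [^] i"
proof -
  have "\<sigma> [^] i = \<sigma> [^] (n * (i div n) + i mod n)" by simp
  also have "\<dots> = (\<sigma> [^] n) [^] (i div n) \<otimes> \<sigma> [^] (i mod n)"
    by (simp only: nat_pow_mult nat_pow_pow sigma_closed)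
  finally show ?thesis by (simp add: sigma_pow)
qed

lemma tau_pow_mod: "\<tau> [^] (j mod 2) = \<tau> [^] (j::nat)"
proof -
  have "\<tau> [^] j = \<tau> [^] (2 * (j div 2) + j mod 2)" by simp
  also have "\<dots> = (\<tau> [^] (2::nat)) [^] (j div 2) \<otimes> \<tau> [^] (j mod 2)"
    by (simp only: nat_pow_mult nat_pow_pow tau_closed)
  finally show ?thesis by (simp add: tau_pow)
qed

lemma inv_sigma:
  assumes "n > 0" shows "inv \<sigma> = \<sigma> [^] (n - 1)"
proof (rule inv_equality)
  show "\<sigma> [^] (n - 1) \<otimes> \<sigma> = \<one>"
    using sigma_pow assms nat_pow_Suc[of \<sigma> "n - 1"] by simp
qed simp_all

lemma inv_tau: "inv \<tau> = \<tau>"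
  using tau_pow by (intro inv_equality) (simp_all add: numeral_2_eq_2)

lemma tau_sigma:
  assumes "n > 0" shows "\<tau> \<otimes> \<sigma> = \<sigma> [^] (n - 1) \<otimes> \<tau>"
proof -
  have "\<tau> \<otimes> \<sigma> = \<tau> \<otimes> \<sigma> \<otimes> inv \<tau> \<otimes> \<tau>" by (simp add: m_assoc)
  then show ?thesis using conj inv_sigma[OF assms] by simp
qed

lemma tau_sigma_pow:
  assumes "n > 0" shows "\<tau> \<otimes> \<sigma> [^] k = \<sigma> [^] (k * (n - 1)) \<otimes> \<tau>"
proof (induction k)
  case (Suc k)
  have "\<tau> \<otimes> \<sigma> [^] Suc k = \<tau> \<otimes> \<sigma> [^] k \<otimes> \<sigma>" by (simp add: m_assoc)
  also have "\<dots> = \<sigma> [^] (k * (n - 1)) \<otimes> (\<tau> \<otimes> \<sigma>)" by (simp add: Suc m_assoc)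
  also have "\<dots> = (\<sigma> [^] (k * (n - 1)) \<otimes> \<sigma> [^] (n - 1)) \<otimes> \<tau>"
    by (simp add: tau_sigma[OF assms] m_assoc)
  finally show ?case by (simp add: nat_pow_mult add.commute)
qed simp

lemma tau_pow_sigma_pow:
  assumes "n > 0" shows "\<tau> [^] j \<otimes> \<sigma> [^] k = \<sigma> [^] (k * (n - 1) ^ j) \<otimes> \<tau> [^] (j::nat)"
proof (induction j arbitrary: k)
  case (Suc j)
  have "\<tau> [^] Suc j \<otimes> \<sigma> [^] k = \<tau> [^] j \<otimes> \<sigma> [^] (k * (n - 1)) \<otimes> \<tau>"
    by (simp add: m_assoc tau_sigma_pow[OF assms])
  then show ?case by (simp add: Suc m_assoc mult.assoc)
qed simp

lemma normal_form_mult: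
  assumes "n > 0"
  shows "(\<sigma> [^] i \<otimes> \<tau> [^] j) \<otimes> (\<sigma> [^] k \<otimes> \<tau> [^] l) =
    \<sigma> [^] ((i + k * (n - 1) ^ j) mod n) \<otimes> \<tau> [^] ((j + l) mod (2::nat))"
proof -
  have "(\<sigma> [^] i \<otimes> \<tau> [^] j) \<otimes> (\<sigma> [^] k \<otimes> \<tau> [^] l) = \<sigma> [^] i \<otimes> (\<tau> [^] j \<otimes> \<sigma> [^] k) \<otimes> \<tau> [^] l"
    by (simp add: m_assoc)
  also have "\<dots> = (\<sigma> [^] i \<otimes> \<sigma> [^] (k * (n - 1) ^ j)) \<otimes> (\<tau> [^] j \<otimes> \<tau> [^] l)"
    by (simp add: tau_pow_sigma_pow[OF assms] m_assoc)
  finally show ?thesis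
    by (simp only: nat_pow_mult sigma_closed tau_closed sigma_pow_mod tau_pow_mod)
qed

end

context dihedral
begin

lemma normal_form_exists:
  assumes "n > 0" "g \<in> carrier G"
  shows "\<exists>i<n. \<exists>j<2. g = \<sigma> [^] i \<otimes> \<tau> [^] (j::nat)"
proof -
  have *: "\<exists>i<n. \<exists>j<2. \<sigma> [^] a \<otimes> \<tau> [^] b = \<sigma> [^] i \<otimes> \<tau> [^] (j::nat)" for a b :: nat
    by (rule exI[of _ "a mod n"], rule conjI, use assms in simp, rule exI[of _ "b mod 2"])
      (simp add: sigma_pow_mod tau_pow_mod)
  have "g \<in> generate G {\<sigma>, \<tau>}" using assms generated by simp
  then show ?thesis
  proof induction
    case one then show ?case using *[of 0 0] by simp
  next
    case (incl h) then show ?case using *[of 1 0] *[of 0 1] by auto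
  next
    case (inv h)
    then have "inv h = \<sigma> [^] (n - 1) \<otimes> \<tau> [^] (0::nat) \<or> inv h = \<sigma> [^] (0::nat) \<otimes> \<tau> [^] (1::nat)"
      using inv_sigma[OF assms(1)] inv_tau by auto
    then show ?case using * by metis
  next
    case (eng g h)
    then show ?case
      using normal_form_mult[OF assms(1)] assms(1)
      by (metis mod_less_divisor zero_less_numeral)
  qed
qed

lemma normal_form_bij:
  assumes "n > 0"
  shows "bij_betw (\<lambda>(i, j). \<sigma> [^] i \<otimes> \<tau> [^] j) ({..<n} \<times> {..<2::nat}) (carrier G)"
proof -
  let ?f = "\<lambda>(i, j). \<sigma> [^] i \<otimes> \<tau> [^] (j::nat)"
  have im: "?f ` ({..<n} \<times> {..<2}) = carrier G"
    using normal_form_exists[OF assms] by (force simp: image_iff)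
  have "card (carrier G) = card ({..<n} \<times> {..<2::nat})"
    using order by (simp add: order_def card_cartesian_product)
  then have "inj_on ?f ({..<n} \<times> {..<2})"
    using im by (intro eq_card_imp_inj_on) simp_all
  with im show ?thesis by (simp add: bij_betw_def)
qed

lemma normal_form_unique:
  assumes "n > 0" "i < n" "j < 2" "i' < n" "j' < (2::nat)"
    and "\<sigma> [^] i \<otimes> \<tau> [^] j = \<sigma> [^] i' \<otimes> \<tau> [^] j'"
  shows "i = i'" "j = j'"
  using bij_betw_imp_inj_on[OF normal_form_bij[OF assms(1)]] assms
  by (auto dest!: inj_onD[of _ _ "(i, j)" "(i', j')"])

theorem hom_exists:
  assumes "n > 0" and "dihedral_relations H n s t"
  shows "\<exists>f \<in> hom G H. f \<sigma> = s \<and> f \<tau> = t"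
proof -
  interpret H: dihedral_relations H n s t by fact
  define F where "F = (\<lambda>(i, j). s [^]\<^bsub>H\<^esub> (i::nat) \<otimes>\<^bsub>H\<^esub> t [^]\<^bsub>H\<^esub> (j::nat))"
  define f where "f = (\<lambda>g. F (inv_into ({..<n} \<times> {..<2::nat}) (\<lambda>(i, j). \<sigma> [^] i \<otimes> \<tau> [^] j) g))"
  have f: "f (\<sigma> [^] i \<otimes> \<tau> [^] j) = s [^]\<^bsub>H\<^esub> i \<otimes>\<^bsub>H\<^esub> t [^]\<^bsub>H\<^esub> j" for i j :: nat
  proof -
    have "inv_into ({..<n} \<times> {..<2::nat}) (\<lambda>(i, j). \<sigma> [^] i \<otimes> \<tau> [^] j)
        ((\<lambda>(i, j). \<sigma> [^] i \<otimes> \<tau> [^] j) (i mod n, j mod 2)) = (i mod n, j mod 2)"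
      using normal_form_bij[OF assms(1)] assms(1)
      by (intro inv_into_f_f) (auto simp: bij_betw_def)
    then show ?thesis
      by (simp add: f_def F_def sigma_pow_mod tau_pow_mod H.sigma_pow_mod H.tau_pow_mod)
  qed
  have "f \<in> hom G H"
  proof (rule homI)
    fix x assume "x \<in> carrier G"
    then show "f x \<in> carrier H" using normal_form_exists[OF assms(1)] f by fastforce
  next
    fix x y assume "x \<in> carrier G" "y \<in> carrier G"
    then obtain i j k l :: nat where "x = \<sigma> [^] i \<otimes> \<tau> [^] (j::nat)" "y = \<sigma> [^] k \<otimes> \<tau> [^] (l::nat)"
      using normal_form_exists[OF assms(1)] by meson
    then show "f (x \<otimes> y) = f x \<otimes>\<^bsub>H\<^esub> f y"
      by (simp only: normal_form_mult[OF assms(1)] H.normal_form_mult[OF assms(1)] f)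
  qed
  moreover have "f \<sigma> = s" "f \<tau> = t" using f[of 1 0] f[of 0 1] by simp_all
  ultimately show ?thesis by blast
qed

end

section \<open>The lattice with basis \<open>w\<^sub>0, \<dots>, w\<^sub>n\<^sub>-\<^sub>1, w'\<close>\<close>

datatype Mtilde_basis = W nat | W'

definition Mtilde_sigma :: "nat \<Rightarrow> (Mtilde_basis \<Rightarrow>\<^sub>0 int) \<Rightarrow> (Mtilde_basis \<Rightarrow>\<^sub>0 int)" where
  "Mtilde_sigma n = frag_extend (\<lambda>b. case b of
       W i \<Rightarrow> frag_of (W ((i + 1) mod n))
     | W' \<Rightarrow> frag_of W')"

definition Mtilde_minus_tau :: "nat \<Rightarrow> (Mtilde_basis \<Rightarrow>\<^sub>0 int) \<Rightarrow> (Mtilde_basis \<Rightarrow>\<^sub>0 int)" where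
  "Mtilde_minus_tau n = frag_extend (\<lambda>b. case b of
       W i \<Rightarrow> - frag_of (W ((n - i) mod n))
     | W' \<Rightarrow> frag_of W' - (\<Sum>i<n. frag_of (W i)))"

text \<open>The action is prescribed on the generators only. An arbitrary element acts according to its
  normal form \<open>\<sigma>\<^sup>i \<tau>\<^sup>j\<close>; in a dihedral group \<open>i < n\<close> and \<open>j < 2\<close> are uniquely determined.\<close>

definition Mtilde_minus_act ::
    "('g, 'r) monoid_scheme \<Rightarrow> nat \<Rightarrow> 'g \<Rightarrow> 'g \<Rightarrow> 'g \<Rightarrow> (Mtilde_basis \<Rightarrow>\<^sub>0 int) \<Rightarrow> (Mtilde_basis \<Rightarrow>\<^sub>0 int)"
  where
  "Mtilde_minus_act G n \<sigma> \<tau> g =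
     (let (i, j) = (SOME (i, j). i < n \<and> j < 2 \<and> g = \<sigma> [^]\<^bsub>G\<^esub> (i::nat) \<otimes>\<^bsub>G\<^esub> \<tau> [^]\<^bsub>G\<^esub> (j::nat))
      in (Mtilde_sigma n ^^ i) \<circ> (Mtilde_minus_tau n ^^ j))"

definition Mtilde_minus ::
    "('g, 'r) monoid_scheme \<Rightarrow> nat \<Rightarrow> 'g \<Rightarrow> 'g \<Rightarrow> ('g \<Rightarrow>\<^sub>0 int, Mtilde_basis \<Rightarrow>\<^sub>0 int) module" where
  "Mtilde_minus G n \<sigma> \<tau> =
     free_module_of_action (insert W' (W ` {..<n})) (Mtilde_minus_act G n \<sigma> \<tau>)"

context dihedral
begin

lemma Mtilde_minus_act_normal_form:
  assumes "i < n" "j < 2"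
  shows "Mtilde_minus_act G n \<sigma> \<tau> (\<sigma> [^] i \<otimes> \<tau> [^] j) = (Mtilde_sigma n ^^ i) \<circ> (Mtilde_minus_tau n ^^ j)"
proof -
  have "(SOME (a, b). a < n \<and> b < 2 \<and> \<sigma> [^] i \<otimes> \<tau> [^] j = \<sigma> [^] a \<otimes> \<tau> [^] (b::nat)) = (i, j)"
    using assms by (intro some_equality) (auto dest: normal_form_unique[rotated -1])
  then show ?thesis by (simp add: Mtilde_minus_act_def)
qed

theorem Mtilde_minus_actions:
  assumes "n \<ge> 3"
  shows "frag_of \<sigma> \<odot>\<^bsub>Mtilde_minus G n \<sigma> \<tau>\<^esub> frag_of (W i) = frag_of (W ((i + 1) mod n))"
    and "frag_of \<tau> \<odot>\<^bsub>Mtilde_minus G n \<sigma> \<tau>\<^esub> frag_of (W i) = - frag_of (W ((n - i) mod n))"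
    and "frag_of \<sigma> \<odot>\<^bsub>Mtilde_minus G n \<sigma> \<tau>\<^esub> frag_of W' = frag_of W'"
    and "frag_of \<tau> \<odot>\<^bsub>Mtilde_minus G n \<sigma> \<tau>\<^esub> frag_of W' = frag_of W' - (\<Sum>i<n. frag_of (W i))"
  using Mtilde_minus_act_normal_form[of 1 0] Mtilde_minus_act_normal_form[of 0 1] assms
  by (simp_all add: Mtilde_minus_def free_module_of_action_def Mtilde_sigma_def Mtilde_minus_tau_def)

end

end

theory Submission
  imports Defs HOL.Modules "HOL-Library.Product_Plus"
begin

text \<open>Write \<open>n = 2p + 1\<close> and let \<open>N\<close> be the sum of the powers of \<open>\<sigma>\<close>. The isomorphism sends
  \<open>w\<^sub>0\<close> to \<open>(1 - \<tau>, 0)\<close>, \<open>w'\<close> to \<open>(N, p + 1)\<close> and the trivial coset \<open>{1, \<tau>}\<close> to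
  \<open>((1 + \<tau>) \<sigma>\<^sup>-\<^sup>p, 1)\<close>. Modulo the image of the \<open>w\<^sub>i\<close>, which identifies \<open>\<sigma>\<^sup>i \<tau>\<close> with \<open>\<sigma>\<^sup>i\<close>, the last
  element becomes \<open>\<sigma>\<^sup>p + \<sigma>\<^sup>-\<^sup>p\<close>, which is a unit modulo \<open>N\<close> because \<open>n\<close> is odd: its values at
  nontrivial characters are cyclotomic units. The second component \<open>p + 1\<close> makes the remaining
  2-by-2 determinant \<open>2(p + 1) - n\<close> equal to 1. Inverting the unit yields the explicit inverse, with
  \<open>(1, 0)\<close> going to \<open>(\<Sum>\<^sub>j w\<^sub>2\<^sub>j - w', \<Sum>\<^sub>j \<sigma>\<^sup>2\<^sup>j\<^sup>-\<^sup>p {1, \<tau>})\<close>, where \<open>0 \<le> j \<le> p\<close>, and \<open>(0, 1)\<close> to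
  \<open>(2w' - \<Sum>\<^sub>i w\<^sub>i, - \<Sum>\<^sub>i \<sigma>\<^sup>i {1, \<tau>})\<close>.\<close>

section \<open>Finitely supported functions\<close>

lemma frag_extend_pointwise_add:
  "frag_extend (\<lambda>g. f g + h g) a = frag_extend f a + frag_extend h a"
  by (simp add: frag_extend_def frag_cmul_distrib2 sum.distrib)

lemma keys_frag_extend_subset:
  assumes "\<And>x. x \<in> Poly_Mapping.keys a \<Longrightarrow> Poly_Mapping.keys (f x) \<subseteq> S"
  shows "Poly_Mapping.keys (frag_extend f a) \<subseteq> S"
  using keys_frag_extend[of f a] assms by blast

lemma keys_add_subset:
  assumes "Poly_Mapping.keys a \<subseteq> S" "Poly_Mapping.keys b \<subseteq> S"
  shows "Poly_Mapping.keys (a + b) \<subseteq> S"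
  using keys_add[of a b] assms by blast

lemma keys_diff_subset:
  fixes a b :: "'a \<Rightarrow>\<^sub>0 int"
  assumes "Poly_Mapping.keys a \<subseteq> S" "Poly_Mapping.keys b \<subseteq> S"
  shows "Poly_Mapping.keys (a - b) \<subseteq> S"
  using keys_diff[of a b] assms by blast

lemma keys_sum_subset:
  assumes "\<And>i. i \<in> I \<Longrightarrow> Poly_Mapping.keys (f i) \<subseteq> S"
  shows "Poly_Mapping.keys (sum f I) \<subseteq> S"
  using assms by (induction I rule: infinite_finite_induct) (simp_all add: keys_add_subset)

lemma keys_cmul_subset:
  assumes "Poly_Mapping.keys a \<subseteq> S"
  shows "Poly_Mapping.keys (frag_cmul k a) \<subseteq> S"
  using keys_cmul[of k a] assms by blast

lemma sum_constant_frag: "(\<Sum>i<m. x) = frag_cmul (int m) x"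
  by (induction m) (simp_all add: frag_cmul_distrib)

text \<open>Elements supported in \<open>S\<close> arise from basis elements by differences, which
  both sides respect. This moves an additive map past the action of a whole group ring
  element.\<close>

lemma frag_extend_commute:
  assumes "Poly_Mapping.keys a \<subseteq> S" and "additive F"
    and "\<And>g. g \<in> S \<Longrightarrow> F (f g) = h g"
  shows "F (frag_extend f a) = frag_extend h a"
  by (rule free_Abelian_group_induct[OF assms(1)])
    (simp_all add: additive.zero[OF assms(2)] additive.diff[OF assms(2)] frag_extend_diff assms(3))

lemma additive_frag_extend: "additive (frag_extend f)"
  by unfold_locales (rule frag_extend_add)

text \<open>The main reduction to generators: multiplicativity of actions, equivariance and the
  inverse identities are checked on basis elements through it.\<close>

lemma additive_eq_on_frags:
  assumes "Poly_Mapping.keys a \<subseteq> S" and "additive F" "additive H"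
    and "\<And>g. g \<in> S \<Longrightarrow> F (frag_of g) = H (frag_of g)"
  shows "F a = H a"
  by (rule free_Abelian_group_induct[OF assms(1)])
    (simp_all add: assms(4) additive.zero[OF assms(2)] additive.zero[OF assms(3)]
      additive.diff[OF assms(2)] additive.diff[OF assms(3)])

section \<open>Augmentation as an additive map\<close>

definition augmentation :: "('b \<Rightarrow>\<^sub>0 int) \<Rightarrow> int" where
  "augmentation a = (\<Sum>g\<in>Poly_Mapping.keys a. Poly_Mapping.lookup a g)"

text \<open>Enlarging the index set adds only zero coefficients; this puts two elements on a common
  finite support.\<close>

lemma augmentation_superset:
  assumes "finite S" "Poly_Mapping.keys a \<subseteq> S"
  shows "augmentation a = (\<Sum>g\<in>S. Poly_Mapping.lookup a g)"
  unfolding augmentation_def using assms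
  by (intro sum.mono_neutral_left) (auto simp: in_keys_iff)

lemma additive_augmentation: "additive augmentation"
proof
  fix a b :: "'b \<Rightarrow>\<^sub>0 int"
  let ?S = "Poly_Mapping.keys a \<union> Poly_Mapping.keys b"
  show "augmentation (a + b) = augmentation a + augmentation b"
    using keys_add[of a b]
    by (simp add: augmentation_superset[of ?S] lookup_add sum.distrib)
qed

lemma augmentation_frag_of [simp]: "augmentation (frag_of x) = 1"
  by (simp add: augmentation_def)

section \<open>Modules over integral group rings\<close>

lemma group_ring_simps [simp]:
  "carrier (group_ring G) = {a. Poly_Mapping.keys a \<subseteq> carrier G}"
  "\<zero>\<^bsub>group_ring G\<^esub> = 0" "\<one>\<^bsub>group_ring G\<^esub> = frag_of \<one>\<^bsub>G\<^esub>" "a \<oplus>\<^bsub>group_ring G\<^esub> b = a + b"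
  "a \<otimes>\<^bsub>group_ring G\<^esub> b = frag_extend (\<lambda>g. frag_extend (\<lambda>h. frag_of (g \<otimes>\<^bsub>G\<^esub> h)) b) a"
  by (auto simp: group_ring_def)

lemma free_module_simps [simp]:
  "carrier (free_module_of_action S act) = {x. Poly_Mapping.keys x \<subseteq> S}"
  "\<zero>\<^bsub>free_module_of_action S act\<^esub> = 0" "x \<oplus>\<^bsub>free_module_of_action S act\<^esub> y = x + y"
  "a \<odot>\<^bsub>free_module_of_action S act\<^esub> x = frag_extend (\<lambda>g. act g x) a"
  by (auto simp: free_module_of_action_def)

lemma trivial_module_simps [simp]:
  "carrier trivial_module = UNIV" "\<zero>\<^bsub>trivial_module\<^esub> = 0" "x \<oplus>\<^bsub>trivial_module\<^esub> y = x + y"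
  "a \<odot>\<^bsub>trivial_module\<^esub> x = augmentation a * x"
  by (auto simp: trivial_module_def augmentation_def)

lemma direct_sum_module_simps [simp]:
  "carrier (direct_sum_module M N) = carrier M \<times> carrier N"
  "\<zero>\<^bsub>direct_sum_module M N\<^esub> = (\<zero>\<^bsub>M\<^esub>, \<zero>\<^bsub>N\<^esub>)"
  "(x, y) \<oplus>\<^bsub>direct_sum_module M N\<^esub> (x', y') = (x \<oplus>\<^bsub>M\<^esub> x', y \<oplus>\<^bsub>N\<^esub> y')"
  "a \<odot>\<^bsub>direct_sum_module M N\<^esub> (x, y) = (a \<odot>\<^bsub>M\<^esub> x, a \<odot>\<^bsub>N\<^esub> y)"
  by (auto simp: direct_sum_module_def)

text \<open>Multiplication in the group ring extends left translation of the basis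
  \<open>carrier G\<close> linearly, so results about \<open>free_module_of_action\<close> cover
  Z[G] as well.\<close>

lemma regular_module_eq:
  "regular_module G =
     free_module_of_action (carrier G) (\<lambda>g. frag_extend (\<lambda>h. frag_of (g \<otimes>\<^bsub>G\<^esub> h)))"
  by (auto simp: regular_module_def group_ring_def free_module_of_action_def)

text \<open>The record stays arbitrary because \<open>group_ring\<close> and
  \<open>free_module_of_action\<close> share this additive structure.\<close>

lemma abelian_group_frags:
  fixes M :: "('b \<Rightarrow>\<^sub>0 int, 'x) ring_scheme"
  assumes "carrier M = {x. Poly_Mapping.keys x \<subseteq> S}" "zero M = 0" "add M = (+)"
  shows "abelian_group M"
proof (rule abelian_groupI)
  fix x assume "x \<in> carrier M"
  then show "\<exists>y\<in>carrier M. y \<oplus>\<^bsub>M\<^esub> x = \<zero>\<^bsub>M\<^esub>"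
    using assms by (intro bexI[of _ "- x"]) simp_all
qed (use assms in \<open>auto intro: subsetD[OF keys_add_subset]\<close>)

section \<open>Linear group actions whose laws are required on a basis\<close>

locale frag_action = group G for G (structure) +
  fixes S :: "'b set" and act :: "'a \<Rightarrow> ('b \<Rightarrow>\<^sub>0 int) \<Rightarrow> ('b \<Rightarrow>\<^sub>0 int)"
  assumes act_additive: "g \<in> carrier G \<Longrightarrow> additive (act g)"
    and act_closed: "\<lbrakk>g \<in> carrier G; b \<in> S\<rbrakk> \<Longrightarrow> Poly_Mapping.keys (act g (frag_of b)) \<subseteq> S"
    and act_mult: "\<lbrakk>g \<in> carrier G; h \<in> carrier G; b \<in> S\<rbrakk> \<Longrightarrow>
      act (g \<otimes> h) (frag_of b) = act g (act h (frag_of b))"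
    and act_one: "b \<in> S \<Longrightarrow> act \<one> (frag_of b) = frag_of b"
begin

lemma act_keys:
  assumes "g \<in> carrier G" "Poly_Mapping.keys x \<subseteq> S"
  shows "Poly_Mapping.keys (act g x) \<subseteq> S"
  by (rule free_Abelian_group_induct[OF assms(2)])
    (simp_all add: assms(1) act_closed additive.zero[OF act_additive] additive.diff[OF act_additive]
      keys_diff_subset)

lemma act_mult_frag:
  assumes "g \<in> carrier G" "h \<in> carrier G" "Poly_Mapping.keys x \<subseteq> S"
  shows "act (g \<otimes> h) x = act g (act h x)"
proof (rule additive_eq_on_frags[OF assms(3)])
  show "additive (\<lambda>x. act g (act h x))"
    using assms by unfold_locales (simp add: additive.add[OF act_additive])
qed (use assms act_additive act_mult in auto)

lemma act_one_frag: "Poly_Mapping.keys x \<subseteq> S \<Longrightarrow> act \<one> x = x"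
  by (rule additive_eq_on_frags) (auto simp: act_additive act_one additive.intro)

lemma smult_add:
  assumes "Poly_Mapping.keys a \<subseteq> carrier G"
  shows "frag_extend (\<lambda>g. act g (x + y)) a =
    frag_extend (\<lambda>g. act g x) a + frag_extend (\<lambda>g. act g y) a"
  unfolding frag_extend_pointwise_add[symmetric]
  using assms by (intro frag_extend_eq) (auto simp: additive.add[OF act_additive])

text \<open>Both sides are additive in \<open>a\<close>, which leaves a single \<open>g\<close>;
  commuting \<open>act g\<close> with the extension over \<open>b\<close> then leaves
  \<open>act_mult_frag\<close>. For the regular action this is associativity of the group
  ring.\<close>

lemma smult_assoc:
  assumes "Poly_Mapping.keys a \<subseteq> carrier G" "Poly_Mapping.keys b \<subseteq> carrier G" "Poly_Mapping.keys x \<subseteq> S"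
  shows "frag_extend (\<lambda>g. act g x) (frag_extend (\<lambda>g. frag_extend (\<lambda>h. frag_of (g \<otimes> h)) b) a) =
    frag_extend (\<lambda>g. act g (frag_extend (\<lambda>h. act h x) b)) a"
proof (rule frag_extend_commute[OF assms(1) additive_frag_extend])
  fix g assume g: "g \<in> carrier G"
  have "frag_extend (\<lambda>g. act g x) (frag_extend (\<lambda>h. frag_of (g \<otimes> h)) b) =
      frag_extend (\<lambda>h. act g (act h x)) b"
    using g assms(3)
    by (intro frag_extend_commute[OF assms(2) additive_frag_extend]) (simp add: act_mult_frag)
  also have "\<dots> = act g (frag_extend (\<lambda>h. act h x) b)"
    by (rule frag_extend_commute[OF assms(2) act_additive[OF g], symmetric]) simp
  finally show "frag_extend (\<lambda>g. act g x) (frag_extend (\<lambda>h. frag_of (g \<otimes> h)) b) =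
      act g (frag_extend (\<lambda>h. act h x) b)" .
qed

end

lemma (in group) frag_action_regular:
  "frag_action G (carrier G) (\<lambda>g. frag_extend (\<lambda>h. frag_of (g \<otimes> h)))"
  by unfold_locales (auto simp: frag_extend_add m_assoc)

lemma (in group) frag_action_permutation:
  assumes "H \<subseteq> carrier G"
  shows "frag_action G (lcosets H) (\<lambda>g. frag_extend (\<lambda>C. frag_of (g <# C)))"
proof
  fix g C assume "g \<in> carrier G" "C \<in> lcosets H"
  then show "Poly_Mapping.keys (frag_extend (\<lambda>C. frag_of (g <# C)) (frag_of C)) \<subseteq> lcosets H"
    using assms by (auto simp: LCOSETS_def lcos_m_assoc)
next
  fix g h C assume "g \<in> carrier G" "h \<in> carrier G" "C \<in> lcosets H"
  then show "frag_extend (\<lambda>C. frag_of (g \<otimes> h <# C)) (frag_of C) =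
      frag_extend (\<lambda>C. frag_of (g <# C)) (frag_extend (\<lambda>C. frag_of (h <# C)) (frag_of C))"
    using assms by (auto simp: LCOSETS_def lcos_m_assoc m_assoc)
next
  fix C assume "C \<in> lcosets H"
  then show "frag_extend (\<lambda>C. frag_of (\<one> <# C)) (frag_of C) = frag_of C"
    using assms by (auto simp: LCOSETS_def lcos_m_assoc)
qed (rule frag_extend_add)

lemma (in group) ring_group_ring: "ring (group_ring G)"
proof -
  interpret reg: frag_action G "carrier G" "\<lambda>g. frag_extend (\<lambda>h. frag_of (g \<otimes> h))"
    by (rule frag_action_regular)
  show ?thesis
  proof (rule ringI)
    show "abelian_group (group_ring G)"
      by (rule abelian_group_frags[of _ "carrier G"]) (auto simp: group_ring_def)
    show "monoid (group_ring G)"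
    proof
      fix x y assume "x \<in> carrier (group_ring G)" "y \<in> carrier (group_ring G)"
      then have "Poly_Mapping.keys (frag_extend (\<lambda>g. frag_extend (\<lambda>h. frag_of (g \<otimes> h)) y) x) \<subseteq> carrier G"
        by (intro keys_frag_extend_subset reg.act_keys) auto
      then show "x \<otimes>\<^bsub>group_ring G\<^esub> y \<in> carrier (group_ring G)" by simp
    next
      fix x y z
      assume "x \<in> carrier (group_ring G)" "y \<in> carrier (group_ring G)" "z \<in> carrier (group_ring G)"
      then show "x \<otimes>\<^bsub>group_ring G\<^esub> y \<otimes>\<^bsub>group_ring G\<^esub> z = x \<otimes>\<^bsub>group_ring G\<^esub> (y \<otimes>\<^bsub>group_ring G\<^esub> z)"
        by (simp add: reg.smult_assoc)
    next
      fix x assume x: "x \<in> carrier (group_ring G)"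
      then show "\<one>\<^bsub>group_ring G\<^esub> \<otimes>\<^bsub>group_ring G\<^esub> x = x"
        by (simp add: reg.act_one_frag)
      have "x \<otimes>\<^bsub>group_ring G\<^esub> \<one>\<^bsub>group_ring G\<^esub> = frag_extend frag_of x"
        using x by (auto intro!: frag_extend_eq)
      then show "x \<otimes>\<^bsub>group_ring G\<^esub> \<one>\<^bsub>group_ring G\<^esub> = x"
        by (simp flip: frag_expansion)
    qed simp
  qed (simp_all add: frag_extend_pointwise_add frag_extend_add)
qed

lemma (in frag_action) left_module: "left_module (group_ring G) (free_module_of_action S act)"
proof -
  interpret R: ring "group_ring G" by (rule ring_group_ring)
  interpret M: abelian_group "free_module_of_action S act"
    by (rule abelian_group_frags[of _ S]) (auto simp: free_module_of_action_def)
  show ?thesis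
    by unfold_locales
      (auto simp: frag_extend_add smult_add smult_assoc act_one_frag
        dest!: subsetD[OF keys_frag_extend_subset[OF act_keys], rotated 2])
qed

text \<open>Scalars act through the augmentation, so the point is its multiplicativity: translation
  by a group element moves coefficients without changing their sum.\<close>

lemma (in group) left_module_trivial: "left_module (group_ring G) trivial_module"
proof -
  interpret R: ring "group_ring G" by (rule ring_group_ring)
  interpret M: abelian_group "trivial_module :: ('a \<Rightarrow>\<^sub>0 int, int) module"
    by (rule abelian_groupI) (auto intro: exI[of _ "- x" for x])
  have mult: "augmentation (frag_extend (\<lambda>g. frag_extend (\<lambda>h. frag_of (g \<otimes> h)) b) a) =
      augmentation a * augmentation b" for a b
  proof -
    have inner: "augmentation (frag_extend (\<lambda>h. frag_of (g \<otimes> h)) b) = augmentation b" for g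
      by (rule additive_eq_on_frags[of b UNIV])
        (simp_all add: additive_def frag_extend_add additive.add[OF additive_augmentation])
    show ?thesis
      by (rule additive_eq_on_frags[of a UNIV])
        (simp_all add: inner additive_def frag_extend_add additive.add[OF additive_augmentation] distrib_right)
  qed
  show ?thesis
    by unfold_locales (auto simp: mult additive.add[OF additive_augmentation] distrib_right distrib_left)
qed

section \<open>Direct sums and torsion-freeness\<close>

lemma left_module_direct_sum:
  assumes "left_module R M" "left_module R N"
  shows "left_module R (direct_sum_module M N)"
proof -
  interpret M: left_module R M by fact
  interpret N: left_module R N by fact
  interpret S: abelian_group "direct_sum_module M N"
  proof (rule abelian_groupI)
    fix x assume "x \<in> carrier (direct_sum_module M N)"
    then show "\<exists>y\<in>carrier (direct_sum_module M N). y \<oplus>\<^bsub>direct_sum_module M N\<^esub> x = \<zero>\<^bsub>direct_sum_module M N\<^esub>"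
      using M.l_neg N.l_neg M.a_inv_closed N.a_inv_closed by fastforce
  qed (auto simp: M.a_ac N.a_ac)
  show ?thesis
    by unfold_locales
      (auto simp: M.smult_closed N.smult_closed M.smult_l_distr N.smult_l_distr M.smult_r_distr
        N.smult_r_distr M.smult_assoc N.smult_assoc M.smult_one N.smult_one)
qed

text \<open>Integer multiples depend only on carrier, operation and unit, so those in a module
  record agree with the known ones in \<open>free_Abelian_group\<close> and
  \<open>integer_group\<close>.\<close>

lemma int_pow_cong:
  assumes "carrier G = carrier H" "monoid.mult G = monoid.mult H" "one G = one H"
  shows "x [^]\<^bsub>G\<^esub> (k :: int) = x [^]\<^bsub>H\<^esub> k"
  using assms by (simp add: int_pow_def nat_pow_def m_inv_def Let_def)

lemma additively_torsion_free_frags: "additively_torsion_free (free_module_of_action S act)"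
proof -
  have "[k] \<cdot>\<^bsub>free_module_of_action S act\<^esub> x = frag_cmul k x"
    if "Poly_Mapping.keys x \<subseteq> S" for k :: int and x
    unfolding add_pow_def int_pow_free_Abelian_group[OF that, symmetric]
    by (rule int_pow_cong) (auto simp: free_module_of_action_def free_Abelian_group_def)
  then show ?thesis by (simp add: additively_torsion_free_def)
qed

lemma additively_torsion_free_trivial:
  "additively_torsion_free (trivial_module :: ('g \<Rightarrow>\<^sub>0 int, int) module)"
proof -
  have "[k] \<cdot>\<^bsub>trivial_module :: ('g \<Rightarrow>\<^sub>0 int, int) module\<^esub> x = k * x" for k x :: int
    unfolding add_pow_def group_int_pow_integer_group[symmetric]
    by (rule int_pow_cong) (auto simp: trivial_module_def integer_group_def)
  then show ?thesis by (simp add: additively_torsion_free_def)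
qed

text \<open>The projections are additive homomorphisms, so a multiple that vanishes does so in each
  component.\<close>

lemma additively_torsion_free_direct_sum:
  assumes "left_module R M" "left_module R N"
    and "additively_torsion_free M" "additively_torsion_free N"
  shows "additively_torsion_free (direct_sum_module M N)"
proof -
  let ?S = "direct_sum_module M N"
  interpret M: left_module R M by fact
  interpret N: left_module R N by fact
  interpret S: left_module R ?S by (intro left_module_direct_sum assms)
  have fst: "fst \<in> hom (add_monoid ?S) (add_monoid M)" and snd: "snd \<in> hom (add_monoid ?S) (add_monoid N)"
    by (auto simp: hom_def)
  show ?thesis
    unfolding additively_torsion_free_def
  proof (intro allI ballI impI)
    fix k :: int and z
    assume z: "z \<in> carrier ?S" and k: "k \<noteq> 0" and eq: "[k] \<cdot>\<^bsub>?S\<^esub> z = \<zero>\<^bsub>?S\<^esub>"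
    have z': "z \<in> carrier (add_monoid ?S)" using z by simp
    have "[k] \<cdot>\<^bsub>M\<^esub> fst z = \<zero>\<^bsub>M\<^esub>"
      using hom_int_pow[OF fst z' S.a_group M.a_group, of k] unfolding add_pow_def[symmetric] eq by simp
    moreover have "[k] \<cdot>\<^bsub>N\<^esub> snd z = \<zero>\<^bsub>N\<^esub>"
      using hom_int_pow[OF snd z' S.a_group N.a_group, of k] unfolding add_pow_def[symmetric] eq by simp
    moreover have "fst z \<in> carrier M" "snd z \<in> carrier N" using z by auto
    ultimately have "fst z = \<zero>\<^bsub>M\<^esub>" "snd z = \<zero>\<^bsub>N\<^esub>"
      using assms(3,4) k unfolding additively_torsion_free_def by blast+
    then show "z = \<zero>\<^bsub>?S\<^esub>" by (simp add: prod_eq_iff)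
  qed
qed

section \<open>Transport of finite generation\<close>

lemma module_iso_inv_into:
  assumes "left_module R M" "f \<in> module_iso R M N"
  shows "inv_into (carrier M) f \<in> module_iso R N M"
proof -
  interpret M: left_module R M by fact
  let ?h = "inv_into (carrier M) f"
  have bij: "bij_betw f (carrier M) (carrier N)"
    and add: "\<And>x y. \<lbrakk>x \<in> carrier M; y \<in> carrier M\<rbrakk> \<Longrightarrow> f (x \<oplus>\<^bsub>M\<^esub> y) = f x \<oplus>\<^bsub>N\<^esub> f y"
    and smult: "\<And>a x. \<lbrakk>a \<in> carrier R; x \<in> carrier M\<rbrakk> \<Longrightarrow> f (a \<odot>\<^bsub>M\<^esub> x) = a \<odot>\<^bsub>N\<^esub> f x"
    using assms(2) by (auto simp: module_iso_def)
  note h = bij_betw_inv_into[OF bij]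
  have hM: "?h y \<in> carrier M" and fh: "f (?h y) = y" if "y \<in> carrier N" for y
    using that h bij by (auto simp: bij_betw_inv_into_right bij_betwE)
  have hf: "?h y = x" if "x \<in> carrier M" "f x = y" for x y
    using that bij by (auto simp: bij_betw_inv_into_left)
  show ?thesis
    unfolding module_iso_def
    by (auto simp: h hM fh add smult M.smult_closed intro!: hf)
qed

text \<open>The image of a generating set generates, with the same coefficients. The left-hand
  lattice of the theorem inherits finite generation in this way from the two evident generators on
  the right.\<close>

lemma finitely_generated_module_iso:
  assumes "left_module R M" "left_module R N" "f \<in> module_iso R M N"
    and "finitely_generated_module R M"
  shows "finitely_generated_module R N"
proof -
  interpret M: left_module R M by fact
  interpret N: left_module R N by fact
  have bij: "bij_betw f (carrier M) (carrier N)"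
    and add: "\<And>x y. \<lbrakk>x \<in> carrier M; y \<in> carrier M\<rbrakk> \<Longrightarrow> f (x \<oplus>\<^bsub>M\<^esub> y) = f x \<oplus>\<^bsub>N\<^esub> f y"
    and smult: "\<And>a x. \<lbrakk>a \<in> carrier R; x \<in> carrier M\<rbrakk> \<Longrightarrow> f (a \<odot>\<^bsub>M\<^esub> x) = a \<odot>\<^bsub>N\<^esub> f x"
    using assms(3) by (auto simp: module_iso_def)
  have fN: "f x \<in> carrier N" if "x \<in> carrier M" for x
    using bij that by (auto simp: bij_betw_def)
  \<comment> \<open>\<open>module_iso\<close> does not mention zero; it is recovered by cancelling
    in f 0 = f 0 + f 0.\<close>
  have f_zero: "f \<zero>\<^bsub>M\<^esub> = \<zero>\<^bsub>N\<^esub>"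
    using add[of "\<zero>\<^bsub>M\<^esub>" "\<zero>\<^bsub>M\<^esub>"] fN[of "\<zero>\<^bsub>M\<^esub>"] N.add.l_cancel_one by simp
  obtain B where B: "B \<subseteq> carrier M" "finite B"
    and gen: "\<And>x. x \<in> carrier M \<Longrightarrow> \<exists>a \<in> B \<rightarrow> carrier R. x = (\<Oplus>\<^bsub>M\<^esub>b\<in>B. a b \<odot>\<^bsub>M\<^esub> b)"
    using assms(4) unfolding finitely_generated_module_def by blast
  have inj: "inj_on f B" using bij B(1) by (auto simp: bij_betw_def intro: inj_on_subset)
  have f_finsum: "f (\<Oplus>\<^bsub>M\<^esub>b\<in>C. u b) = (\<Oplus>\<^bsub>N\<^esub>b\<in>C. f (u b))"
    if "finite C" "u \<in> C \<rightarrow> carrier M" for C u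
    using that
  proof (induction C rule: finite_induct)
    case (insert c C)
    then show ?case
      by (subst M.finsum_insert, simp_all, subst N.finsum_insert) (auto simp: add fN Pi_def)
  qed (simp add: f_zero)
  show ?thesis
    unfolding finitely_generated_module_def
  proof (intro exI conjI ballI)
    show "f ` B \<subseteq> carrier N" "finite (f ` B)" using B fN by auto
    fix y assume "y \<in> carrier N"
    then obtain x where x: "x \<in> carrier M" "y = f x" using bij by (auto simp: bij_betw_def)
    with gen obtain a where a: "a \<in> B \<rightarrow> carrier R" and xa: "x = (\<Oplus>\<^bsub>M\<^esub>b\<in>B. a b \<odot>\<^bsub>M\<^esub> b)" by blast
    \<comment> \<open>Coefficients are carried to the image set by inverting \<open>f\<close> on
      \<open>B\<close>, where it is injective.\<close>
    let ?a = "\<lambda>b. a (inv_into B f b)"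
    have a': "?a \<in> f ` B \<rightarrow> carrier R" using a inj by auto
    have "y = (\<Oplus>\<^bsub>N\<^esub>b\<in>B. f (a b \<odot>\<^bsub>M\<^esub> b))"
      unfolding x xa using a B by (intro f_finsum) (auto intro!: M.smult_closed)
    also have "\<dots> = (\<Oplus>\<^bsub>N\<^esub>b\<in>B. ?a (f b) \<odot>\<^bsub>N\<^esub> f b)"
      using a B inj fN by (intro N.finsum_cong') (auto simp: smult Pi_def intro!: N.smult_closed)
    also have "\<dots> = (\<Oplus>\<^bsub>N\<^esub>c\<in>f ` B. ?a c \<odot>\<^bsub>N\<^esub> c)"
      using a B inj fN a' by (subst N.finsum_reindex) (auto intro!: N.smult_closed)
    finally show "\<exists>a\<in>f ` B \<rightarrow> carrier R. y = (\<Oplus>\<^bsub>N\<^esub>c\<in>f ` B. a c \<odot>\<^bsub>N\<^esub> c)"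
      using a' by (rule bexI[where x = ?a])
  qed
qed

lemma (in group) finitely_generated_regular_plus_trivial:
  "finitely_generated_module (group_ring G) (direct_sum_module (regular_module G) trivial_module)"
proof -
  let ?N = "direct_sum_module (regular_module G) trivial_module"
  interpret reg: frag_action G "carrier G" "\<lambda>g. frag_extend (\<lambda>h. frag_of (g \<otimes> h))"
    by (rule frag_action_regular)
  interpret N: left_module "group_ring G" ?N
    unfolding regular_module_eq by (intro left_module_direct_sum reg.left_module left_module_trivial)
  let ?b = "(frag_of \<one>, 0 :: int)" and ?c = "(0 :: 'a \<Rightarrow>\<^sub>0 int, 1 :: int)"
  show ?thesis
    unfolding finitely_generated_module_def
  proof (intro exI[of _ "{?b, ?c}"] conjI ballI)
    show "{?b, ?c} \<subseteq> carrier ?N" by (simp add: regular_module_eq)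
    fix x assume "x \<in> carrier ?N"
    then obtain a k where x: "x = (a, k)" and a: "Poly_Mapping.keys a \<subseteq> carrier G"
      by (auto simp: regular_module_eq)
    \<comment> \<open>The element (a, k) has coefficient \<open>a\<close> at (1, 0) and, at (0, 1),
      \<open>k\<close> times the identity, whose augmentation is \<open>k\<close>.\<close>
    define u where "u = (\<lambda>y. if y = ?b then a else frag_cmul k (frag_of \<one>))"
    define v where "v y = u y \<odot>\<^bsub>?N\<^esub> y" for y
    have u: "u \<in> {?b, ?c} \<rightarrow> carrier (group_ring G)"
      using a by (auto simp: u_def)
    have v: "v ?b \<in> carrier ?N" "v ?c \<in> carrier ?N"
      unfolding v_def using u by (intro N.smult_closed; simp add: regular_module_eq)+
    have "frag_extend (\<lambda>g. frag_of (g \<otimes> \<one>)) a = frag_extend frag_of a"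
      using a by (auto intro!: frag_extend_eq)
    then have "v ?b = (a, 0)"
      by (simp add: v_def u_def regular_module_eq frag_expansion[symmetric])
    moreover have "v ?c = (0, k)"
    proof -
      have "augmentation (frag_cmul k (frag_of \<one>)) = k"
        by (subst augmentation_superset[of "{\<one>}"]) (auto simp: keys_cmul_subset)
      moreover have "frag_extend (\<lambda>g. frag_extend (\<lambda>h. frag_of (g \<otimes> h)) 0) (u ?c) = 0"
        by (rule frag_extend_eq_0) simp
      ultimately show ?thesis by (simp add: v_def u_def regular_module_eq)
    qed
    ultimately have "v ?b \<oplus>\<^bsub>?N\<^esub> v ?c = x"
      by (simp add: x regular_module_eq)
    moreover have "(\<Oplus>\<^bsub>?N\<^esub>y\<in>{?b, ?c}. v y) = v ?b \<oplus>\<^bsub>?N\<^esub> v ?c"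
      using v N.finsum_insert[of "{?c}" ?b v] N.finsum_insert[of "{}" ?c v] N.r_zero[of "v ?c"]
      by (simp del: direct_sum_module_simps)
    ultimately have "x = (\<Oplus>\<^bsub>?N\<^esub>y\<in>{?b, ?c}. u y \<odot>\<^bsub>?N\<^esub> y)"
      by (simp only: v_def)
    then show "\<exists>a\<in>{?b, ?c} \<rightarrow> carrier (group_ring G). x = (\<Oplus>\<^bsub>?N\<^esub>y\<in>{?b, ?c}. a y \<odot>\<^bsub>?N\<^esub> y)"
      using u by (rule bexI)
  qed simp
qed

section \<open>Sums of periodic functions\<close>

text \<open>A full period can start anywhere: moving the start by one exchanges \<open>u k\<close>
  for the equal term \<open>u (k + n)\<close>. Induction over the integers moves it in both
  directions.\<close>

lemma sum_periodic_shift: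
  fixes u :: "int \<Rightarrow> 'b::ab_group_add"
  assumes periodic: "\<And>i. u (i + int n) = u i"
  shows "(\<Sum>i<n. u (k + int i)) = (\<Sum>i<n. u (int i))"
proof (cases n)
  case (Suc m)
  have step: "(\<Sum>i<n. u (k + 1 + int i)) = (\<Sum>i<n. u (k + int i))" for k
  proof -
    have "(\<Sum>i<n. u (k + int i)) = u k + (\<Sum>i<m. u (k + 1 + int i))"
      unfolding Suc sum.lessThan_Suc_shift by (simp add: algebra_simps)
    moreover have "u k = u (k + 1 + int m)"
      using periodic[of k] Suc by (simp add: algebra_simps)
    ultimately show ?thesis by (simp add: Suc add.commute)
  qed
  show ?thesis
  proof (induction k rule: int_induct[of _ 0])
    case (step2 i) then show ?case using step[of "i - 1"] by simp
  qed (simp_all add: step)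
qed simp

text \<open>Reversing the order turns the descending run into an ascending one that starts at
  \<open>k - (n - 1)\<close>.\<close>

lemma sum_periodic_flip:
  fixes u :: "int \<Rightarrow> 'b::ab_group_add"
  assumes periodic: "\<And>i. u (i + int n) = u i"
  shows "(\<Sum>i<n. u (k - int i)) = (\<Sum>i<n. u (int i))"
proof -
  have "(\<Sum>i<n. u (k - int i)) = (\<Sum>i<n. u (k - int (n - 1) + int (n - Suc i)))"
    by (intro sum.cong refl arg_cong[where f = u]) auto
  also have "\<dots> = (\<Sum>i<n. u (k - int (n - 1) + int i))"
    by (rule sum.nat_diff_reindex)
  finally show ?thesis using sum_periodic_shift[of u, OF periodic] by simp
qed

text \<open>Substitution of \<open>p - j\<close> for \<open>j\<close>; it makes the sums produced by
  rotations and by mirrors comparable.\<close>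

lemma sum_even_steps_reverse:
  fixes u :: "int \<Rightarrow> 'b::ab_group_add"
  shows "(\<Sum>j<Suc p. u (k - 2 * int j)) = (\<Sum>j<Suc p. u (k - 2 * int p + 2 * int j))"
proof -
  have "(\<Sum>j<Suc p. u (k - 2 * int j)) = (\<Sum>j<Suc p. u (k - 2 * int p + 2 * int (Suc p - Suc j)))"
    by (intro sum.cong refl arg_cong[where f = u]) auto
  also have "\<dots> = (\<Sum>j<Suc p. u (k - 2 * int p + 2 * int j))"
    by (rule sum.nat_diff_reindex)
  finally show ?thesis .
qed

text \<open>Modulo 2p + 1 the progressions k, k + 2, ..., k + 2p and k, k - 2, ..., k - 2p together
  meet every residue once, except that k is met twice. In the group ring this says that \<sigma>^p +
  \<sigma>^(-p) times the sum of the \<sigma>^(2j - p) is 1 + N, which inverts the unit modulo N.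
  Oddness of n enters here.\<close>

lemma sum_even_steps_both_directions:
  fixes u :: "int \<Rightarrow> 'b::ab_group_add"
  assumes periodic: "\<And>i. u (i + int (2 * p + 1)) = u i"
  shows "(\<Sum>j<Suc p. u (k + 2 * int j)) + (\<Sum>j<Suc p. u (k - 2 * int j)) =
    u k + (\<Sum>i<2 * p + 1. u (int i))"
proof -
  \<comment> \<open>After reversal the last term is \<open>u k\<close>, the one counted twice; a
    period added to the others puts them at odd offsets from \<open>k\<close>.\<close>
  have "(\<Sum>j<Suc p. u (k - 2 * int j)) = u (k - 2 * int p + 2 * int p) + (\<Sum>j<p. u (k - 2 * int p + 2 * int j))"
    unfolding sum_even_steps_reverse by simp
  moreover have "u (k - 2 * int p + 2 * int j) = u (k + 2 * int j + 1)" for j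
    using periodic[of "k - 2 * int p + 2 * int j"] by (simp add: algebra_simps)
  \<comment> \<open>Even and odd offsets interleave to a run of consecutive integers.\<close>
  moreover have "(\<Sum>j<Suc m. u (k + 2 * int j)) + (\<Sum>j<m. u (k + 2 * int j + 1)) =
      (\<Sum>i<2 * m + 1. u (k + int i))" for m
    by (induction m) (simp_all add: algebra_simps)
  ultimately show ?thesis
    using sum_periodic_shift[of u "2 * p + 1" k] periodic by (simp add: algebra_simps)
qed

section \<open>Dihedral groups of odd degree\<close>

locale odd_dihedral = dihedral +
  fixes p :: nat
  assumes n_eq: "n = 2 * p + 1"
begin

lemma n_pos: "n > 0" by (simp add: n_eq)

lemma int_n_pos: "int n > 0" by (simp add: n_eq)

section \<open>Normal forms with integer exponents, read modulo n\<close>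

definition rot :: "int \<Rightarrow> 'a" where "rot i = \<sigma> [^] i"
definition mirror :: "int \<Rightarrow> 'a" where "mirror i = rot i \<otimes> \<tau>"

lemma rot_closed [simp]: "rot i \<in> carrier G" by (simp add: rot_def)
lemma mirror_closed [simp]: "mirror i \<in> carrier G" by (simp add: mirror_def)

lemma rot_rot: "rot i \<otimes> rot j = rot (i + j)" by (simp add: rot_def int_pow_mult)

lemma rot_multiple: "rot (int n * q) = \<one>"
proof -
  have "rot (int n * q) = (\<sigma> [^] int n) [^] q"
    by (simp add: rot_def int_pow_pow)
  then show ?thesis by (simp add: int_pow_int sigma_pow)
qed

lemma rot_eq: "rot (i + int n * q) = rot i"
  by (simp add: rot_rot[symmetric] rot_multiple)

lemma rot_mod: "rot (i mod int n) = rot i"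
  using rot_eq[of "i mod int n" "i div int n"] by simp

lemma nat_mod_less: "nat (i mod int n) < n"
  using int_n_pos pos_mod_bound[of "int n" i] by (simp add: nat_less_iff)

lemma rot_nat: "rot i = \<sigma> [^] nat (i mod int n)"
  using rot_mod[of i] int_n_pos by (simp add: rot_def flip: int_pow_int)

lemma tau_rot: "\<tau> \<otimes> rot i = rot (- i) \<otimes> \<tau>"
proof -
  let ?k = "nat (i mod int n)"
  have "\<tau> \<otimes> rot i = \<sigma> [^] (?k * (n - 1)) \<otimes> \<tau>"
    unfolding rot_nat by (rule tau_sigma_pow[OF n_pos])
  also have "\<sigma> [^] (?k * (n - 1)) = rot (int (?k * (n - 1)))"
    by (simp only: rot_def int_pow_int)
  also have "int (?k * (n - 1)) = (i mod int n) * (int n - 1)"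
    using int_n_pos by (simp add: of_nat_diff)
  \<comment> \<open>With k = i mod n, the exponent k (n - 1) differs from -i by a multiple of
    n.\<close>
  also have "\<dots> = - i + int n * (i div int n + i mod int n)"
    using minus_mult_div_eq_mod[of i "int n"] by (simp add: algebra_simps)
  finally show ?thesis by (simp only: rot_eq)
qed

lemma rot_mirror: "rot i \<otimes> mirror j = mirror (i + j)"
  by (simp add: mirror_def rot_rot flip: m_assoc)

lemma mirror_rot: "mirror i \<otimes> rot j = mirror (i - j)"
proof -
  have "mirror i \<otimes> rot j = rot i \<otimes> (\<tau> \<otimes> rot j)" by (simp add: mirror_def m_assoc)
  then show ?thesis by (simp add: tau_rot mirror_def rot_rot flip: m_assoc)
qed

lemma tau_tau: "\<tau> \<otimes> \<tau> = \<one>"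
  using tau_pow by (simp add: numeral_2_eq_2)

lemma mirror_mirror: "mirror i \<otimes> mirror j = rot (i - j)"
proof -
  have "mirror i \<otimes> mirror j = (mirror i \<otimes> rot j) \<otimes> \<tau>" by (simp add: mirror_def m_assoc)
  also have "\<dots> = rot (i - j) \<otimes> (\<tau> \<otimes> \<tau>)" unfolding mirror_rot by (simp add: mirror_def m_assoc)
  finally show ?thesis by (simp add: tau_tau)
qed

lemma one_eq_rot: "\<one> = rot 0" by (simp add: rot_def)
lemma tau_eq_mirror: "\<tau> = mirror 0" by (simp add: mirror_def rot_def)

lemmas dihedral_mult = rot_rot rot_mirror mirror_rot mirror_mirror

lemma rot_periodic: "rot (i + int n) = rot i" using rot_eq[of i 1] by simp
lemma mirror_periodic: "mirror (i + int n) = mirror i" by (simp add: mirror_def rot_periodic)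

text \<open>Equality would force \<tau> = 1, against uniqueness of the normal form. Hence each
  \<open>coset i\<close> has two elements, on which \<open>psi_c\<close> relies.\<close>

lemma rot_neq_mirror: "rot i \<noteq> mirror i"
proof
  assume "rot i = mirror i"
  then have "\<tau> = \<one>" by (simp add: mirror_def)
  then have "\<sigma> [^] (0::nat) \<otimes> \<tau> [^] (0::nat) = \<sigma> [^] (0::nat) \<otimes> \<tau> [^] (1::nat)" by simp
  from normal_form_unique(2)[OF n_pos n_pos _ n_pos _ this] show False by simp
qed

lemma element_cases:
  assumes "g \<in> carrier G"
  obtains (rot) i where "g = rot i" | (mirror) i where "g = mirror i"
proof -
  from normal_form_exists[OF n_pos assms] obtain i j :: nat
    where g: "j < 2" "g = \<sigma> [^] i \<otimes> \<tau> [^] (j::nat)" by blast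
  then have "j = 0 \<or> j = 1" by auto
  then show thesis
    using g that(1)[of "int i"] that(2)[of "int i"] by (auto simp: mirror_def rot_def int_pow_int)
qed

section \<open>Left cosets of the subgroup generated by \<tau>\<close>

definition coset :: "int \<Rightarrow> 'a set" where "coset i = {rot i, mirror i}"

lemma rot_coset: "rot k <# coset i = coset (k + i)"
  by (auto simp: coset_def l_coset_def dihedral_mult)

lemma mirror_coset: "mirror k <# coset i = coset (k - i)"
  by (auto simp: coset_def l_coset_def dihedral_mult)

lemma coset_periodic: "coset (i + int n) = coset i"
  by (simp add: coset_def rot_periodic mirror_periodic)

lemma generate_tau: "generate G {\<tau>} = coset 0"
proof
  show "generate G {\<tau>} \<subseteq> coset 0"
  proof
    fix g assume "g \<in> generate G {\<tau>}"
    then show "g \<in> coset 0"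
      by induction (auto simp: coset_def inv_tau tau_tau simp flip: one_eq_rot tau_eq_mirror)
  qed
  show "coset 0 \<subseteq> generate G {\<tau>}"
    by (auto simp: coset_def generate.one generate.incl simp flip: one_eq_rot tau_eq_mirror)
qed

lemma lcosets_tau: "lcosets (generate G {\<tau>}) = range coset"
proof
  show "lcosets (generate G {\<tau>}) \<subseteq> range coset"
    unfolding LCOSETS_def generate_tau
    by (auto elim!: element_cases simp: rot_coset mirror_coset)
  have "coset i \<in> lcosets (generate G {\<tau>})" for i
    unfolding LCOSETS_def generate_tau using rot_coset[of i 0] by force
  then show "range coset \<subseteq> lcosets (generate G {\<tau>})" by blast
qed

section \<open>The action on the lattice \<open>Mtilde_minus\<close>\<close>

abbreviation "act \<equiv> Mtilde_minus_act G n \<sigma> \<tau>"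
abbreviation "basis \<equiv> insert W' (W ` {..<n})"

text \<open>Indices run over all integers with reduction modulo n built in, so the action becomes
  arithmetic on indices and the lemmas on periodic sums apply.\<close>

definition w :: "int \<Rightarrow> Mtilde_basis \<Rightarrow>\<^sub>0 int" where "w i = frag_of (W (nat (i mod int n)))"
definition w_sum :: "Mtilde_basis \<Rightarrow>\<^sub>0 int" where "w_sum = (\<Sum>i<n. w (int i))"

lemma w_periodic: "w (i + int n) = w i" by (simp add: w_def)

lemma w_mod: "w (i + j mod int n) = w (i + j)" by (simp add: w_def mod_add_right_eq)

lemma frag_of_W: "i < n \<Longrightarrow> frag_of (W i) = w (int i)" by (simp add: w_def)

lemma additive_funpow:
  fixes f :: "'c::ab_group_add \<Rightarrow> 'c"
  shows "additive f \<Longrightarrow> additive (f ^^ k)"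
  by (induction k) (simp_all add: additive_def)

text \<open>Whatever exponents \<open>SOME\<close> returns, the result composes powers of two
  additive maps.\<close>

lemma additive_act: "g \<in> carrier G \<Longrightarrow> additive (act g)"
  by (auto simp: Mtilde_minus_act_def Let_def additive_def Mtilde_sigma_def Mtilde_minus_tau_def
    additive.add[OF additive_funpow[OF additive_frag_extend]] split: prod.split)

lemma sigma_pow_w: "(Mtilde_sigma n ^^ k) (w i) = w (i + int k)"
proof (induction k)
  case (Suc k)
  have "Mtilde_sigma n (w j) = w (j + 1)" for j
  proof -
    have "(nat (j mod int n) + 1) mod n = nat ((j + 1) mod int n)"
      using int_n_pos by (simp add: nat_mod_as_int mod_simps add.commute)
    then show ?thesis by (simp add: Mtilde_sigma_def w_def)
  qed
  then show ?case by (simp add: Suc algebra_simps)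
qed simp

lemma tau_w: "Mtilde_minus_tau n (w i) = - w (- i)"
proof -
  have "int (n - nat (i mod int n)) = int n - i mod int n"
    using int_n_pos nat_mod_less[of i] by (simp add: of_nat_diff)
  then have "(n - nat (i mod int n)) mod n = nat ((- i) mod int n)"
    by (simp add: nat_mod_as_int mod_simps)
  then show ?thesis by (simp add: Mtilde_minus_tau_def w_def)
qed

lemma sigma_pow_W': "(Mtilde_sigma n ^^ k) (frag_of W') = frag_of W'"
  by (induction k) (simp_all add: Mtilde_sigma_def)

lemma tau_W': "Mtilde_minus_tau n (frag_of W') = frag_of W' - w_sum"
  by (simp add: Mtilde_minus_tau_def w_sum_def frag_of_W)

lemma act_rot: "act (rot k) = Mtilde_sigma n ^^ nat (k mod int n)"
  using Mtilde_minus_act_normal_form[of "nat (k mod int n)" 0] nat_mod_less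
  by (simp add: rot_nat)

lemma act_mirror: "act (mirror k) = (Mtilde_sigma n ^^ nat (k mod int n)) \<circ> Mtilde_minus_tau n"
  using Mtilde_minus_act_normal_form[of "nat (k mod int n)" 1] nat_mod_less
  by (simp add: rot_nat mirror_def)

lemma additive_sigma_pow: "additive (Mtilde_sigma n ^^ k)"
  unfolding Mtilde_sigma_def by (intro additive_funpow additive_frag_extend)

lemma act_rot_w: "act (rot k) (w i) = w (k + i)"
  using int_n_pos by (simp add: act_rot sigma_pow_w w_mod add.commute)

lemma act_mirror_w: "act (mirror k) (w i) = - w (k - i)"
  using int_n_pos w_mod[of "- i" k]
  by (simp add: act_mirror sigma_pow_w tau_w additive.minus[OF additive_sigma_pow])

lemma act_rot_W': "act (rot k) (frag_of W') = frag_of W'"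
  by (simp add: act_rot sigma_pow_W')

lemma act_rot_w_sum: "act (rot k) w_sum = w_sum"
  by (simp add: w_sum_def additive.sum[OF additive_act] act_rot_w sum_periodic_shift w_periodic)

lemma act_mirror_w_sum: "act (mirror k) w_sum = - w_sum"
  by (simp add: w_sum_def additive.sum[OF additive_act] act_mirror_w sum_negf sum_periodic_flip w_periodic)

lemma act_mirror_W': "act (mirror k) (frag_of W') = frag_of W' - w_sum"
proof -
  have "act (mirror k) (frag_of W') = act (rot k) (frag_of W' - w_sum)"
    by (simp add: act_mirror act_rot tau_W')
  then show ?thesis
    by (simp add: additive.diff[OF additive_act] act_rot_W' act_rot_w_sum)
qed

lemmas act_simps = act_rot_w act_mirror_w act_rot_W' act_mirror_W' act_rot_w_sum act_mirror_w_sum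
  additive.diff[OF additive_act] additive.minus[OF additive_act] additive.sum[OF additive_act]

lemma keys_w: "Poly_Mapping.keys (w i) \<subseteq> basis"
  using nat_mod_less[of i] by (simp add: w_def)

lemma keys_w_sum: "Poly_Mapping.keys w_sum \<subseteq> basis"
  unfolding w_sum_def by (intro keys_sum_subset keys_w)

lemma basis_cases:
  assumes "b \<in> basis"
  obtains (W) i where "frag_of b = w i" | (W') "b = W'"
  using assms frag_of_W by blast

text \<open>An action prescribed through normal forms must be shown to respect products; the rules
  for rotations and mirrors settle all four kinds of product on both kinds of basis vector. Two
  mirrors fix \<open>W'\<close> because their two contributions of \<open>w_sum\<close>
  cancel.\<close>

lemma frag_action_Mtilde: "frag_action G basis act"
proof
  fix g b assume "g \<in> carrier G" "b \<in> basis"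
  then show "Poly_Mapping.keys (act g (frag_of b)) \<subseteq> basis"
    by (elim element_cases basis_cases)
      (simp_all add: act_simps keys_w keys_w_sum keys_diff_subset)
next
  fix g h b assume "g \<in> carrier G" "h \<in> carrier G" "b \<in> basis"
  then show "act (g \<otimes> h) (frag_of b) = act g (act h (frag_of b))"
    by (elim element_cases basis_cases) (simp_all add: act_simps dihedral_mult algebra_simps)
next
  fix b assume "b \<in> basis"
  then show "act \<one> (frag_of b) = frag_of b"
    by (elim basis_cases) (simp_all add: act_simps one_eq_rot)
qed (simp add: additive.add[OF additive_act])

section \<open>Z[G] and Z[G/<\<tau>>] with integer indices\<close>

abbreviation "reg \<equiv> \<lambda>g. frag_extend (\<lambda>h. frag_of (g \<otimes> h))"
abbreviation "perm \<equiv> \<lambda>g. frag_extend (\<lambda>C. frag_of (g <# C))"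

interpretation M: frag_action G basis act by (rule frag_action_Mtilde)
interpretation R: frag_action G "carrier G" reg by (rule frag_action_regular)
interpretation P: frag_action G "range coset" perm
proof -
  have "generate G {\<tau>} \<subseteq> carrier G" by (simp add: generate_tau coset_def)
  from frag_action_permutation[OF this] show "frag_action G (range coset) perm"
    by (simp only: lcosets_tau)
qed

definition r :: "int \<Rightarrow> 'a \<Rightarrow>\<^sub>0 int" where "r i = frag_of (rot i)"
definition s :: "int \<Rightarrow> 'a \<Rightarrow>\<^sub>0 int" where "s i = frag_of (mirror i)"
definition c :: "int \<Rightarrow> 'a set \<Rightarrow>\<^sub>0 int" where "c i = frag_of (coset i)"
definition r_sum where "r_sum = (\<Sum>i<n. r (int i))"
definition s_sum where "s_sum = (\<Sum>i<n. s (int i))"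
definition c_sum where "c_sum = (\<Sum>i<n. c (int i))"

lemma rsc_periodic: "r (i + int n) = r i" "s (i + int n) = s i" "c (i + int n) = c i"
  by (simp_all add: r_def s_def c_def rot_periodic mirror_periodic coset_periodic)

lemma reg_simps:
  "reg (rot k) (r i) = r (k + i)" "reg (rot k) (s i) = s (k + i)"
  "reg (mirror k) (r i) = s (k - i)" "reg (mirror k) (s i) = r (k - i)"
  by (simp_all add: r_def s_def dihedral_mult)

lemma perm_simps: "perm (rot k) (c i) = c (k + i)" "perm (mirror k) (c i) = c (k - i)"
  by (simp_all add: c_def rot_coset mirror_coset)

lemma reg_r_sum: "reg (rot k) r_sum = r_sum" "reg (mirror k) r_sum = s_sum"
  by (simp_all add: r_sum_def s_sum_def additive.sum[OF additive_frag_extend] reg_simps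
    sum_periodic_shift sum_periodic_flip rsc_periodic)

lemma keys_rsc: "Poly_Mapping.keys (r i) \<subseteq> carrier G" "Poly_Mapping.keys (s i) \<subseteq> carrier G"
  "Poly_Mapping.keys (c i) \<subseteq> range coset"
  by (auto simp: r_def s_def c_def)

section \<open>The isomorphism and its inverse\<close>

text \<open>First component on \<open>Mtilde_minus\<close>. The value at \<open>W k\<close> is
  \<sigma>^k times that at \<open>W 0\<close>, as equivariance forces.\<close>

definition phi :: "(Mtilde_basis \<Rightarrow>\<^sub>0 int) \<Rightarrow> ('a \<Rightarrow>\<^sub>0 int)" where
  "phi = frag_extend (\<lambda>b. case b of W k \<Rightarrow> r (int k) - s (int k) | W' \<Rightarrow> r_sum)"

text \<open>Summing a coset gives \<sigma>^k (1 + \<tau>); the further factor \<sigma>^(-p) stands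
  on the right, where it commutes with the left action.\<close>

definition psi :: "('a set \<Rightarrow>\<^sub>0 int) \<Rightarrow> ('a \<Rightarrow>\<^sub>0 int)" where
  "psi = frag_extend (\<lambda>C. \<Sum>g\<in>C. frag_of (g \<otimes> rot (- int p)))"

definition to_regular :: "(Mtilde_basis \<Rightarrow>\<^sub>0 int) \<times> ('a set \<Rightarrow>\<^sub>0 int) \<Rightarrow> ('a \<Rightarrow>\<^sub>0 int) \<times> int" where
  "to_regular = (\<lambda>(x, y). (phi x + psi y, int (p + 1) * Poly_Mapping.lookup x W' + augmentation y))"

text \<open>A homomorphism out of Z[G] is determined by the image of 1; \<open>alpha\<close> and
  \<open>beta\<close> are the orbit maps of the two components of that image.\<close>

definition alpha :: "('a \<Rightarrow>\<^sub>0 int) \<Rightarrow> (Mtilde_basis \<Rightarrow>\<^sub>0 int)" where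
  "alpha = frag_extend (\<lambda>g. act g ((\<Sum>j<Suc p. w (2 * int j)) - frag_of W'))"

definition beta :: "('a \<Rightarrow>\<^sub>0 int) \<Rightarrow> ('a set \<Rightarrow>\<^sub>0 int)" where
  "beta = frag_extend (\<lambda>g. perm g (\<Sum>j<Suc p. c (2 * int j - int p)))"

text \<open>Both \<open>frag_of W' + frag_of W' - w_sum\<close> and \<open>c_sum\<close> are fixed
  by G, as the image of a generator of the trivial lattice must be.\<close>

definition from_regular :: "('a \<Rightarrow>\<^sub>0 int) \<times> int \<Rightarrow> (Mtilde_basis \<Rightarrow>\<^sub>0 int) \<times> ('a set \<Rightarrow>\<^sub>0 int)" where
  "from_regular = (\<lambda>(a, k). (alpha a + frag_cmul k (frag_of W' + frag_of W' - w_sum),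
     beta a - frag_cmul k c_sum))"

lemma additive_maps: "additive phi" "additive psi" "additive alpha" "additive beta"
  unfolding phi_def psi_def alpha_def beta_def by (rule additive_frag_extend)+

lemmas additive_maps_simps =
  additive_maps[THEN additive.add] additive_maps[THEN additive.diff]
  additive_maps[THEN additive.minus] additive_maps[THEN additive.zero]
  additive_maps[THEN additive.sum]

lemma additive_to_regular: "additive to_regular"
  by unfold_locales
    (auto simp: to_regular_def additive_maps_simps lookup_add algebra_simps
      additive.add[OF additive_augmentation])

lemma additive_from_regular: "additive from_regular"
  by unfold_locales
    (auto simp: from_regular_def additive_maps_simps frag_cmul_distrib algebra_simps)

section \<open>Values of the maps on basis elements\<close>

lemma phi_w: "phi (w k) = r k - s k"
  using int_n_pos by (simp add: phi_def w_def r_def s_def rot_mod mirror_def)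

lemma phi_W': "phi (frag_of W') = r_sum"
  by (simp add: phi_def)

lemma phi_w_sum: "phi w_sum = r_sum - s_sum"
  by (simp add: w_sum_def r_sum_def s_sum_def additive_maps_simps phi_w sum_subtractf)

lemma psi_c: "psi (c k) = r (k - int p) + s (k + int p)"
  using rot_neq_mirror[of k] by (simp add: psi_def c_def coset_def r_def s_def dihedral_mult)

lemma lookup_W': "Poly_Mapping.lookup (w k) W' = 0" "Poly_Mapping.lookup w_sum W' = 0"
  by (simp_all add: w_sum_def w_def lookup_sum)

lemma augmentation_c: "augmentation (c k) = 1" "augmentation c_sum = int n"
  by (simp_all add: c_def c_sum_def additive.sum[OF additive_augmentation])

lemma alpha_r: "alpha (r k) = (\<Sum>j<Suc p. w (k + 2 * int j)) - frag_of W'"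
  by (simp add: alpha_def r_def act_simps del: sum.lessThan_Suc)

lemma alpha_s: "alpha (s k) = w_sum - (\<Sum>j<Suc p. w (k - 2 * int j)) - frag_of W'"
  by (simp add: alpha_def s_def act_simps sum_negf del: sum.lessThan_Suc)

lemma beta_r: "beta (r k) = (\<Sum>j<Suc p. c (k - int p + 2 * int j))"
  by (simp add: beta_def r_def additive.sum[OF additive_frag_extend] perm_simps algebra_simps
    del: sum.lessThan_Suc)

text \<open>The value agrees with \<open>beta (r k)\<close> because the image of 1 under
  \<open>beta\<close> is fixed by \<tau>. Hence \<open>beta\<close> kills every
  \<open>r k - s k\<close>.\<close>

lemma beta_s: "beta (s k) = (\<Sum>j<Suc p. c (k - int p + 2 * int j))"
proof -
  have "beta (s k) = (\<Sum>j<Suc p. c (k + int p - 2 * int j))"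
    by (simp add: beta_def s_def additive.sum[OF additive_frag_extend] perm_simps algebra_simps
      del: sum.lessThan_Suc)
  then show ?thesis unfolding sum_even_steps_reverse by (simp add: algebra_simps)
qed

text \<open>The first instance yields alpha (r k - s k) = w k, the second evaluates
  \<open>beta (psi (c k))\<close>, and the last two recover \<open>r k\<close> and
  \<open>s k\<close> in the opposite composition.\<close>

lemma sum_even_steps:
  "(\<Sum>j<Suc p. w (k + 2 * int j)) + (\<Sum>j<Suc p. w (k - 2 * int j)) = w k + w_sum"
  "(\<Sum>j<Suc p. c (k + 2 * int j)) + (\<Sum>j<Suc p. c (k - 2 * int j)) = c k + c_sum"
  "(\<Sum>j<Suc p. r (k + 2 * int j)) + (\<Sum>j<Suc p. r (k - 2 * int j)) = r k + r_sum"
  "(\<Sum>j<Suc p. s (k + 2 * int j)) + (\<Sum>j<Suc p. s (k - 2 * int j)) = s k + s_sum"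
  unfolding w_sum_def c_sum_def r_sum_def s_sum_def
  by (intro sum_even_steps_both_directions[where p = p, folded n_eq] w_periodic rsc_periodic)+

section \<open>The two maps are mutually inverse on generators\<close>

lemma from_to_w: "from_regular (to_regular (w k, 0)) = (w k, 0)"
  using sum_even_steps(1)[of k]
  by (simp add: from_regular_def to_regular_def phi_w lookup_W' additive_maps_simps alpha_r alpha_s
    beta_r beta_s additive.zero[OF additive_augmentation] algebra_simps del: sum.lessThan_Suc)

text \<open>\<open>W'\<close> goes to (\<open>r_sum\<close>, p + 1). Under \<open>alpha\<close> and
  \<open>beta\<close>, \<open>r_sum\<close> yields p + 1 copies of \<open>w_sum\<close> and of
  \<open>c_sum\<close>, which the second component cancels; the coefficient left at
  \<open>W'\<close> is 2(p + 1) - n = 1.\<close>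

lemma from_to_W': "from_regular (to_regular (frag_of W', 0)) = (frag_of W', 0)"
proof -
  \<comment> \<open>For each fixed \<open>j\<close> the sum over \<open>i\<close> is a full period,
    so all p + 1 of them agree.\<close>
  have swap: "(\<Sum>i<n. \<Sum>j<Suc p. u (int i + v j)) = frag_cmul (1 + int p) (\<Sum>i<n. u (int i))"
    if "\<And>i. u (i + int n) = u i" for u :: "int \<Rightarrow> 'c \<Rightarrow>\<^sub>0 int" and v
  proof -
    have "(\<Sum>i<n. \<Sum>j<Suc p. u (int i + v j)) = (\<Sum>j<Suc p. \<Sum>i<n. u (v j + int i))"
      by (subst sum.swap) (simp only: add.commute)
    then show ?thesis
      using sum_periodic_shift[of u, OF that]
      by (simp add: sum_constant_frag del: sum.lessThan_Suc)
  qed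
  have "alpha r_sum = frag_cmul (1 + int p) w_sum - frag_cmul (int n) (frag_of W')"
    using swap[of w "\<lambda>j. 2 * int j"]
    by (simp add: r_sum_def additive_maps_simps alpha_r sum_subtractf sum_constant_frag w_periodic
      w_sum_def del: sum.lessThan_Suc)
  moreover have "beta r_sum = frag_cmul (1 + int p) c_sum"
    using swap[of c "\<lambda>j. 2 * int j - int p"]
    by (simp add: r_sum_def additive_maps_simps beta_r rsc_periodic c_sum_def algebra_simps
      del: sum.lessThan_Suc)
  ultimately show ?thesis
    by (simp add: from_regular_def to_regular_def phi_W' additive_maps_simps
      additive.zero[OF additive_augmentation])
      (rule poly_mapping_eqI, simp add: lookup_add lookup_minus n_eq algebra_simps)
qed

text \<open>The two summands of \<open>psi (c k)\<close> contribute the same even-step sum with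
  opposite signs, which leaves w_sum - 2 W'. The second component 1 cancels this, and also the
  surplus \<open>c_sum\<close> coming from \<open>beta\<close>.\<close>

lemma from_to_c: "from_regular (to_regular (0, c k)) = (0, c k)"
proof -
  have "alpha (psi (c k)) = w_sum - frag_of W' - frag_of W'"
    using sum_even_steps_reverse[where u = w and p = p and k = "k + int p"]
    by (simp add: psi_c additive_maps_simps alpha_r alpha_s algebra_simps del: sum.lessThan_Suc)
  moreover have "beta (psi (c k)) = c k + c_sum"
    using sum_even_steps(2)[of k] sum_even_steps_reverse[where u = c and p = p and k = k]
    by (simp add: psi_c additive_maps_simps beta_r beta_s algebra_simps del: sum.lessThan_Suc)
  ultimately show ?thesis
    by (simp add: from_regular_def to_regular_def additive_maps_simps augmentation_c algebra_simps)
qed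

text \<open>The \<open>s\<close> terms of \<open>phi\<close> and \<open>psi\<close> cancel, while
  the \<open>r\<close> terms form both even-step progressions, whose surplus \<open>r_sum\<close> is
  removed by the image of -W'. The second component is -(p + 1) + (p + 1).\<close>

lemma to_from_r: "to_regular (from_regular (r k, 0)) = (r k, 0)"
proof -
  have "phi (alpha (r k)) + psi (beta (r k)) = r k"
    using sum_even_steps(3)[of k] sum_even_steps_reverse[where u = r and p = p and k = k]
    by (simp add: alpha_r beta_r additive_maps_simps phi_w phi_W' psi_c sum.distrib sum_subtractf
      algebra_simps del: sum.lessThan_Suc)
  then show ?thesis
    by (simp add: to_regular_def from_regular_def alpha_r beta_r lookup_minus lookup_sum lookup_W'
      additive.sum[OF additive_augmentation] augmentation_c del: sum.lessThan_Suc)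
qed

text \<open>The roles are exchanged: the \<open>r\<close> terms cancel after reversal, and the
  \<open>s\<close> terms form both progressions.\<close>

lemma to_from_s: "to_regular (from_regular (s k, 0)) = (s k, 0)"
proof -
  have "phi (alpha (s k)) + psi (beta (s k)) = s k"
    using sum_even_steps(4)[of k] sum_even_steps_reverse[where u = r and p = p and k = k]
    by (simp add: alpha_s beta_s additive_maps_simps phi_w phi_W' phi_w_sum psi_c sum.distrib
      sum_subtractf algebra_simps del: sum.lessThan_Suc)
  then show ?thesis
    by (simp add: to_regular_def from_regular_def alpha_s beta_s lookup_minus lookup_sum lookup_W'
      additive.sum[OF additive_augmentation] augmentation_c del: sum.lessThan_Suc)
qed

text \<open>\<open>phi\<close> at 2 W' - w_sum and \<open>psi\<close> at \<open>c_sum\<close> both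
  equal \<open>r_sum + s_sum\<close>, so the first component vanishes; the second is k (2(p + 1) -
  n) = k.\<close>

lemma to_from_int: "to_regular (from_regular (0, k)) = (0, k)"
proof -
  have "psi c_sum = r_sum + s_sum"
  proof -
    have "psi c_sum = (\<Sum>i<n. r (- int p + int i)) + (\<Sum>i<n. s (int p + int i))"
      by (simp add: c_sum_def additive_maps_simps psi_c sum.distrib algebra_simps)
    then show ?thesis
      using sum_periodic_shift[of r n "- int p", OF rsc_periodic(1)]
        sum_periodic_shift[of s n "int p", OF rsc_periodic(2)]
      by (simp add: r_sum_def s_sum_def)
  qed
  moreover have "phi (frag_cmul k x) = frag_cmul k (phi x)" "psi (frag_cmul k y) = frag_cmul k (psi y)"
    for x y by (simp_all add: phi_def psi_def frag_extend_cmul)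
  moreover have "augmentation (frag_cmul k c_sum) = k * int n"
    by (subst augmentation_superset[of "Poly_Mapping.keys c_sum"])
      (simp_all add: keys_cmul_subset augmentation_c(2)[unfolded augmentation_def] flip: sum_distrib_left)
  moreover have "int n = 1 + 2 * int p" by (simp add: n_eq)
  ultimately show ?thesis
    by (simp add: to_regular_def from_regular_def additive_maps_simps phi_W' phi_w_sum lookup_add
      lookup_minus lookup_W' additive.minus[OF additive_augmentation] algebra_simps
      frag_cmul_distrib2 del: minus_frag_cmul)
qed

abbreviation "lhs \<equiv> direct_sum_module (Mtilde_minus G n \<sigma> \<tau>) (permutation_module G (generate G {\<tau>}))"
abbreviation "rhs \<equiv> direct_sum_module (regular_module G) trivial_module"

lemma lhs_eq: "lhs = direct_sum_module (free_module_of_action basis act) (free_module_of_action (range coset) perm)"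
  by (simp add: Mtilde_minus_def permutation_module_def lcosets_tau)

lemma from_to:
  assumes "z \<in> carrier lhs"
  shows "from_regular (to_regular z) = z"
proof -
  obtain x y where z: "z = (x, y)" and x: "Poly_Mapping.keys x \<subseteq> basis"
    and y: "Poly_Mapping.keys y \<subseteq> range coset"
    using assms unfolding lhs_eq by auto
  note additive = additive.add[OF additive_to_regular] additive.add[OF additive_from_regular]
  have "from_regular (to_regular (x, 0)) = (x, 0)"
  proof (rule additive_eq_on_frags[OF x])
    show "additive (\<lambda>x. from_regular (to_regular (x, 0)))"
      by unfold_locales (metis additive add_Pair add.left_neutral)
    show "additive (\<lambda>x. (x, 0))" by unfold_locales simp
  qed (elim basis_cases, simp_all add: from_to_w from_to_W')
  moreover have "from_regular (to_regular (0, y)) = (0, y)"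
  proof (rule additive_eq_on_frags[OF y])
    show "additive (\<lambda>y. from_regular (to_regular (0, y)))"
      by unfold_locales (metis additive add_Pair add.left_neutral)
    show "additive (\<lambda>y. (0, y))" by unfold_locales simp
  qed (use from_to_c in \<open>auto simp: c_def\<close>)
  moreover have "z = (x, 0) + (0, y)" by (simp add: z)
  ultimately show ?thesis by (simp only: additive)
qed

lemma to_from:
  assumes "z \<in> carrier rhs"
  shows "to_regular (from_regular z) = z"
proof -
  obtain a k where z: "z = (a, k)" and a: "Poly_Mapping.keys a \<subseteq> carrier G"
    using assms by (auto simp: regular_module_eq)
  note additive = additive.add[OF additive_to_regular] additive.add[OF additive_from_regular]
  have "to_regular (from_regular (a, 0)) = (a, 0)"
  proof (rule additive_eq_on_frags[OF a])
    show "additive (\<lambda>a. to_regular (from_regular (a, 0)))"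
      by unfold_locales (metis additive add_Pair add.left_neutral)
    show "additive (\<lambda>a. (a, 0))" by unfold_locales simp
  qed (elim element_cases, use to_from_r to_from_s in \<open>simp_all add: r_def s_def\<close>)
  moreover have "z = (a, 0) + (0, k)" by (simp add: z)
  ultimately show ?thesis by (simp only: additive to_from_int)
qed

section \<open>Carriers and equivariance\<close>

lemma to_regular_closed:
  assumes "z \<in> carrier lhs"
  shows "to_regular z \<in> carrier rhs"
proof -
  obtain x y where z: "z = (x, y)" and x: "Poly_Mapping.keys x \<subseteq> basis"
    and y: "Poly_Mapping.keys y \<subseteq> range coset"
    using assms unfolding lhs_eq by auto
  have "Poly_Mapping.keys (phi x) \<subseteq> carrier G"
    unfolding phi_def r_sum_def
    by (rule keys_frag_extend_subset)
      (auto split: Mtilde_basis.split simp: keys_rsc keys_diff_subset keys_sum_subset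
        dest!: subsetD[OF keys_diff_subset, rotated 2] subsetD[OF keys_sum_subset, rotated 1])
  moreover have "Poly_Mapping.keys (psi y) \<subseteq> carrier G"
    unfolding psi_def
  proof (intro keys_frag_extend_subset keys_sum_subset)
    fix C g assume "C \<in> Poly_Mapping.keys y" "g \<in> C"
    then have "g \<in> carrier G" using y by (auto simp: coset_def)
    then show "Poly_Mapping.keys (frag_of (g \<otimes> rot (- int p))) \<subseteq> carrier G" by simp
  qed
  ultimately show ?thesis
    by (simp add: z to_regular_def regular_module_eq keys_add_subset)
qed

lemma from_regular_closed:
  assumes "z \<in> carrier rhs"
  shows "from_regular z \<in> carrier lhs"
proof -
  obtain a k where z: "z = (a, k)" and a: "Poly_Mapping.keys a \<subseteq> carrier G"
    using assms by (auto simp: regular_module_eq)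
  have "Poly_Mapping.keys (alpha a) \<subseteq> basis"
    unfolding alpha_def
    by (intro keys_frag_extend_subset M.act_keys keys_diff_subset keys_sum_subset keys_w)
      (use a in auto)
  moreover have "Poly_Mapping.keys (beta a) \<subseteq> range coset"
    unfolding beta_def
    by (intro keys_frag_extend_subset[of a] P.act_keys keys_sum_subset keys_rsc) (use a in auto)
  moreover have "Poly_Mapping.keys (frag_cmul k (frag_of W' + frag_of W' - w_sum)) \<subseteq> basis"
    by (intro keys_cmul_subset keys_diff_subset keys_add_subset keys_w_sum) auto
  moreover have "Poly_Mapping.keys (frag_cmul k c_sum) \<subseteq> range coset"
    unfolding c_sum_def by (intro keys_cmul_subset keys_sum_subset keys_rsc)
  ultimately show ?thesis
    unfolding lhs_eq by (simp add: z from_regular_def keys_add_subset keys_diff_subset)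
qed

text \<open>At \<open>W'\<close> a mirror must give \<open>s_sum\<close>; the correction term in its
  action does this, since \<open>phi\<close> sends W' - w_sum to r_sum - (r_sum - s_sum).\<close>

lemma phi_act:
  assumes "g \<in> carrier G" "Poly_Mapping.keys x \<subseteq> basis"
  shows "phi (act g x) = reg g (phi x)"
proof (rule additive_eq_on_frags[OF assms(2)])
  show "additive (\<lambda>x. phi (act g x))" "additive (\<lambda>x. reg g (phi x))"
    using assms(1) by (simp_all add: additive_def M.act_additive[THEN additive.add]
      additive_maps_simps frag_extend_add)
  fix b assume "b \<in> basis"
  with assms(1) show "phi (act g (frag_of b)) = reg g (phi (frag_of b))"
    by (elim element_cases basis_cases)
      (simp_all add: act_simps phi_w phi_W' phi_w_sum additive_maps_simps frag_extend_diff
        reg_simps reg_r_sum)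
qed

text \<open>Every group element preserves the span of the \<open>w i\<close> and fixes
  \<open>W'\<close> modulo it.\<close>

lemma lookup_W'_act:
  assumes "g \<in> carrier G" "Poly_Mapping.keys x \<subseteq> basis"
  shows "Poly_Mapping.lookup (act g x) W' = Poly_Mapping.lookup x W'"
proof (rule additive_eq_on_frags[OF assms(2)])
  show "additive (\<lambda>x. Poly_Mapping.lookup (act g x) W')" "additive (\<lambda>x. Poly_Mapping.lookup x W' :: int)"
    using assms(1) by (simp_all add: additive_def M.act_additive[THEN additive.add] lookup_add)
  fix b assume "b \<in> basis"
  with assms(1) show "Poly_Mapping.lookup (act g (frag_of b)) W' = Poly_Mapping.lookup (frag_of b) W'"
    by (elim element_cases basis_cases)
      (simp_all add: act_simps lookup_W' lookup_minus)
qed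

lemma psi_perm:
  assumes "g \<in> carrier G" "Poly_Mapping.keys y \<subseteq> range coset"
  shows "psi (perm g y) = reg g (psi y)"
proof (rule additive_eq_on_frags[OF assms(2)])
  show "additive (\<lambda>y. psi (perm g y))" "additive (\<lambda>y. reg g (psi y))"
    by (simp_all add: additive_def additive_maps_simps frag_extend_add)
  fix C assume "C \<in> range coset"
  then obtain k where "frag_of C = c k" by (auto simp: c_def)
  with assms(1) show "psi (perm g (frag_of C)) = reg g (psi (frag_of C))"
    by (elim element_cases) (simp_all add: perm_simps psi_c frag_extend_add reg_simps algebra_simps)
qed

lemma augmentation_perm: "augmentation (perm g y) = augmentation y"
  by (rule additive_eq_on_frags[of y UNIV])
    (simp_all add: additive_def frag_extend_add additive.add[OF additive_augmentation])

text \<open>Equivariance under group elements extends linearly. In the second component both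
  functionals are invariant, so \<open>a\<close> acts on their values by its augmentation, which is
  its action on the trivial lattice.\<close>

lemma to_regular_smult:
  assumes a: "Poly_Mapping.keys a \<subseteq> carrier G" and z: "z \<in> carrier lhs"
  shows "to_regular (a \<odot>\<^bsub>lhs\<^esub> z) = a \<odot>\<^bsub>rhs\<^esub> to_regular z"
proof -
  obtain x y where xy: "z = (x, y)" and x: "Poly_Mapping.keys x \<subseteq> basis"
    and y: "Poly_Mapping.keys y \<subseteq> range coset"
    using z unfolding lhs_eq by auto
  have "phi (frag_extend (\<lambda>g. act g x) a) = frag_extend (\<lambda>g. reg g (phi x)) a"
    by (rule frag_extend_commute[OF a additive_maps(1)]) (simp add: phi_act x)
  moreover have "psi (frag_extend (\<lambda>g. perm g y) a) = frag_extend (\<lambda>g. reg g (psi y)) a"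
    by (rule frag_extend_commute[OF a additive_maps(2)]) (simp add: psi_perm y)
  moreover have "Poly_Mapping.lookup (frag_extend (\<lambda>g. act g x) a) W' =
      augmentation a * Poly_Mapping.lookup x W'"
    by (rule additive_eq_on_frags[OF a])
      (simp_all add: lookup_W'_act x additive_def frag_extend_add lookup_add algebra_simps
        additive.add[OF additive_augmentation])
  moreover have "augmentation (frag_extend (\<lambda>g. perm g y) a) = augmentation a * augmentation y"
    by (rule additive_eq_on_frags[OF a])
      (simp_all add: augmentation_perm additive_def frag_extend_add algebra_simps
        additive.add[OF additive_augmentation])
  ultimately show ?thesis
    unfolding lhs_eq
    by (simp add: xy to_regular_def regular_module_eq R.smult_add[OF a] algebra_simps)
qed

section \<open>Assembly of the lattice isomorphism\<close>

lemma to_regular_iso: "to_regular \<in> module_iso (group_ring G) lhs rhs"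
  unfolding module_iso_def
proof (intro CollectI conjI ballI)
  show "bij_betw to_regular (carrier lhs) (carrier rhs)"
    by (rule bij_betw_byWitness[where f' = from_regular])
      (auto simp: from_to to_from to_regular_closed from_regular_closed simp del: direct_sum_module_simps)
next
  fix z z' assume "z \<in> carrier lhs" "z' \<in> carrier lhs"
  \<comment> \<open>Addition in both records is addition of pairs, so
    \<open>additive_to_regular\<close> applies to it.\<close>
  have "z \<oplus>\<^bsub>lhs\<^esub> z' = z + z'" for z z'
    unfolding lhs_eq by (cases z; cases z') simp
  moreover have "z \<oplus>\<^bsub>rhs\<^esub> z' = z + z'" for z z'
    by (cases z; cases z') (simp add: regular_module_eq)
  ultimately show "to_regular (z \<oplus>\<^bsub>lhs\<^esub> z') = to_regular z \<oplus>\<^bsub>rhs\<^esub> to_regular z'"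
    by (simp only: additive.add[OF additive_to_regular])
qed (rule to_regular_smult, simp_all del: direct_sum_module_simps)

lemma lattices_isomorphic: "G_lattices_isomorphic G lhs rhs"
proof -
  have lhs: "left_module (group_ring G) lhs"
    unfolding lhs_eq by (intro left_module_direct_sum M.left_module P.left_module)
  have rhs: "left_module (group_ring G) rhs"
    unfolding regular_module_eq by (intro left_module_direct_sum R.left_module left_module_trivial)
  have "additively_torsion_free lhs"
    unfolding lhs_eq
    by (rule additively_torsion_free_direct_sum[OF M.left_module P.left_module])
      (rule additively_torsion_free_frags)+
  moreover have "additively_torsion_free rhs"
    unfolding regular_module_eq
    by (rule additively_torsion_free_direct_sum[OF R.left_module left_module_trivial])
      (rule additively_torsion_free_frags additively_torsion_free_trivial)+
  moreover note finitely_generated_regular_plus_trivial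
  moreover from this have "finitely_generated_module (group_ring G) lhs"
    by (rule finitely_generated_module_iso[OF rhs lhs module_iso_inv_into[OF lhs to_regular_iso]])
  ultimately show ?thesis
    unfolding G_lattices_isomorphic_def G_lattice_def using lhs rhs to_regular_iso by blast
qed

end

theorem theorem3p5:
  fixes G :: "('g, 'r) monoid_scheme" and n :: nat and \<sigma> \<tau> :: 'g
  assumes "n \<ge> 3" and "odd n"
    and "dihedral G n \<sigma> \<tau>"
  shows "G_lattices_isomorphic G
           (direct_sum_module (Mtilde_minus G n \<sigma> \<tau>) (permutation_module G (generate G {\<tau>})))
           (direct_sum_module (regular_module G) trivial_module)"
proof -
  from assms(2) obtain p where "n = 2 * p + 1" by (elim oddE)
  then interpret odd_dihedral G n \<sigma> \<tau> p
    using assms(3) by (simp add: odd_dihedral_def odd_dihedral_axioms_def)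
  show ?thesis by (rule lattices_isomorphic)
qed

end
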